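(* Let $\mathcal X\subset\mathbb R^n$, let $g$ and $h_1,\dots,h_k$ be real-valued $C^\infty$ functions of $(x,y)\in\mathcal X\times\mathbb R^m$, and let $\mathcal Y(x)=\{y\in\mathbb R^m: h_i(x,y)\le 0,\ i=1,\dots,k\}$ be nonempty for every $x\in\mathcal X$. Fix $x\in\mathcal X$. Suppose $\mathcal Y(x)$ is bounded, LICQ and SCSC hold for the lower-level problem $\min_{y\in\mathcal Y(x)}g(x,y)$ at $x$, and the KKT matrix $$\begin{pmatrix}\nabla^2_{yy}L(x,y,\lambda)&\nabla_y h_{\mathcal J(x,y)}(x,y)^\top\\ \nabla_y h_{\mathcal J(x,y)}(x,y)&0\end{pmatrix}$$ is nonsingular at every KKT pair $(y,\lambda)$ of the lower-level problem at $x$. Then for any compact sets $K_{\rm in},K_{\rm out}\subset\mathbb R^m$ with $\mathcal Y(x)\subset\operatorname{int}(K_{\rm in})$ and $K_{\rm in}\subset\operatorname{int}(K_{\rm out})$ there exists a constant $\epsilon=\epsilon(x,K_{\rm in},K_{\rm out})>0$ such that for any $C^2$ perturbations $s(x,\cdot)$ of the objective and $r_i(x,\cdot)$ of the constraints with $$\|s(x,\cdot)\|_{C^2(K_{\rm out})}+\max_i\|r_i(x,\cdot)\|_{C^2(K_{\rm out})}\le\epsilon,$$ and for every $\mathcal J\subseteq\{1,\dots,k\}$, $$\#\{\text{local minimizers of the original problem in }\mathcal S_{\mathcal J}(x)\}=\#\{\text{local minimizers of the perturbed problem in }\widetilde{\mathcal S}_{\mathcal J}(x)\cap K_{\rm 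in}\}.$$
   Context: Perturbed problem: $\min_y \widetilde g(x,y)=g(x,y)+s(x,y)$ subject to $\widetilde h_i(x,y)=h_i(x,y)+r_i(x,y)\le 0$, $i=1,\dots,k$. Active set: $\mathcal J(x,y)=\{i:h_i(x,y)=0\}$. Strata: $\mathcal S_{\mathcal J}(x)=\{y\in\mathcal Y(x):\mathcal J(x,y)=\mathcal J\}$; $\widetilde{\mathcal S}_{\mathcal J}(x)$ is defined analogously as the set of points $y$ feasible for the perturbed problem with $\{i:\widetilde h_i(x,y)=0\}=\mathcal J$. KKT pair at $x$: $(y,\lambda)\in\mathbb R^m\times\mathbb R^k$ with $\nabla_y g(x,y)+\sum_i\lambda_i\nabla_y h_i(x,y)=0$, $h_i(x,y)\le 0$, $\lambda_i\ge 0$, $\lambda_i h_i(x,y)=0$ for all $i$. Lagrangian: $L(x,y,\lambda)=g(x,y)+\sum_i\lambda_i h_i(x,y)$ (multipliers of inactive constraints vanish at KKT pairs). $\nabla_y h_{\mathcal J}(x,y)$ is the $|\mathcal J|\times m$ matrix with rows $\nabla_y h_j(x,y)^\top$, $j\in\mathcal J$ (if $\mathcal J$ is empty the KKT matrix is just $\nabla^2_{yy}L$). LICQ holds at $x$ if for every $y\in\mathcal Y(x)$ the vectors $\{\nabla_y h_i(x,y): i\in\mathcal J(x,y)\}$ are linearly independent. SCSC holds at $x$ if for every KKT pair $(y^\ast,\lambda^\ast)$ at $x$ and every $i$, either $h_i(x,y^\ast)<0$ and $\lambda^\ast_i=0$, or $h_i(x,y^\ast)=0$ and $\lambda^\ast_i>0$.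 Compact-local norm: for compact $K\subset\mathbb R^m$ and $\phi$ of class $C^2$ near $K$, $\|\phi\|_{C^2(K)}=\max\{\sup_{K}|\phi|,\ \sup_{K}\|\nabla\phi\|,\ \sup_{K}\|\nabla^2\phi\|_{\rm op}\}$; for $\phi(x,y)$ it is taken in $y$ with $x$ fixed. *)

theory Defs
  imports "HOL-Analysis.Analysis"
begin

section \<open>Differentiability classes\<close>

text \<open>
  \<open>Ck_on k f U\<close> is meant for open \<open>U\<close>: the Frechet derivative is taken in full neighbourhoods,
  and \<open>f\<close> is of class \<open>C^(k+1)\<close> iff it is differentiable with all partial derivatives of class
  \<open>C^k\<close>.
\<close>

fun Ck_on :: "nat \<Rightarrow> ('a::euclidean_space \<Rightarrow> real) \<Rightarrow> 'a set \<Rightarrow> bool" where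
  "Ck_on 0 f U \<longleftrightarrow> continuous_on U f"
| "Ck_on (Suc k) f U \<longleftrightarrow>
     (\<forall>z\<in>U. f differentiable (at z)) \<and>
     (\<forall>b\<in>Basis. Ck_on k (\<lambda>z. frechet_derivative f (at z) b) U)"

definition C2_near :: "('a::euclidean_space \<Rightarrow> real) \<Rightarrow> 'a set \<Rightarrow> bool" where
  "C2_near f K \<longleftrightarrow> (\<exists>U. open U \<and> K \<subseteq> U \<and> Ck_on 2 f U)"

text \<open>
  Smoothness on a set that need not be open has the usual meaning: near each point of the set
  the function has a smooth extension to an open neighbourhood.
\<close>

definition smooth_on_set :: "('a::euclidean_space \<Rightarrow> real) \<Rightarrow> 'a set \<Rightarrow> bool" where
  "smooth_on_set f S \<longleftrightarrow>
     (\<forall>p\<in>S. \<exists>U F. open U \<and> p \<in> U \<and> (\<forall>k. Ck_on k F U) \<and> (\<forall>q\<in>S \<inter> U. F q = f q))"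

definition grad :: "(real^'m \<Rightarrow> real) \<Rightarrow> real^'m \<Rightarrow> real^'m" where
  "grad f y = (\<chi> i. frechet_derivative f (at y) (axis i 1))"

definition hess :: "(real^'m \<Rightarrow> real) \<Rightarrow> real^'m \<Rightarrow> real^'m^'m" where
  "hess f y = matrix (frechet_derivative (grad f) (at y))"

definition C2_norm :: "(real^'m) set \<Rightarrow> (real^'m \<Rightarrow> real) \<Rightarrow> real" where
  "C2_norm K f =
     Max {SUP y\<in>K. \<bar>f y\<bar>, SUP y\<in>K. norm (grad f y), SUP y\<in>K. onorm ((*v) (hess f y))}"

section \<open>The parametric lower-level problem\<close>

text \<open>The constraint functions are the family \<open>h\<close>, indexed by the finite type \<open>'k\<close>.\<close>

definition feasible :: "('k \<Rightarrow> real^'n \<Rightarrow> real^'m \<Rightarrow> real) \<Rightarrow> real^'n \<Rightarrow> (real^'m) set" where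
  "feasible h x = {y. \<forall>i. h i x y \<le> 0}"

definition active :: "('k \<Rightarrow> real^'n \<Rightarrow> real^'m \<Rightarrow> real) \<Rightarrow> real^'n \<Rightarrow> real^'m \<Rightarrow> 'k set" where
  "active h x y = {i. h i x y = 0}"

definition stratum ::
  "('k \<Rightarrow> real^'n \<Rightarrow> real^'m \<Rightarrow> real) \<Rightarrow> 'k set \<Rightarrow> real^'n \<Rightarrow> (real^'m) set" where
  "stratum h J x = {y \<in> feasible h x. active h x y = J}"

definition local_minimizer ::
  "(real^'n \<Rightarrow> real^'m \<Rightarrow> real) \<Rightarrow> ('k \<Rightarrow> real^'n \<Rightarrow> real^'m \<Rightarrow> real) \<Rightarrow> real^'n \<Rightarrow> real^'m \<Rightarrow> bool"
  where
  "local_minimizer g h x y \<longleftrightarrow>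
     y \<in> feasible h x \<and>
     (\<exists>\<delta>>0. \<forall>z\<in>feasible h x. dist z y < \<delta> \<longrightarrow> g x y \<le> g x z)"

definition KKT_pair ::
  "(real^'n \<Rightarrow> real^'m \<Rightarrow> real) \<Rightarrow> ('k::finite \<Rightarrow> real^'n \<Rightarrow> real^'m \<Rightarrow> real) \<Rightarrow> real^'n
    \<Rightarrow> real^'m \<Rightarrow> real^'k \<Rightarrow> bool" where
  "KKT_pair g h x y l \<longleftrightarrow>
     grad (g x) y + (\<Sum>i\<in>UNIV. (l $ i) *\<^sub>R grad (h i x) y) = 0 \<and>
     (\<forall>i. h i x y \<le> 0 \<and> l $ i \<ge> 0 \<and> l $ i * h i x y = 0)"

definition Lagrangian ::
  "(real^'n \<Rightarrow> real^'m \<Rightarrow> real) \<Rightarrow> ('k::finite \<Rightarrow> real^'n \<Rightarrow> real^'m \<Rightarrow> real) \<Rightarrow> real^'n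
    \<Rightarrow> real^'m \<Rightarrow> real^'k \<Rightarrow> real" where
  "Lagrangian g h x y l = g x y + (\<Sum>i\<in>UNIV. l $ i * h i x y)"

text \<open>
  Linear independence is that of the indexed family of gradients, hence the injectivity clause:
  two active constraints with the same gradient violate LICQ.
\<close>

definition LICQ :: "('k \<Rightarrow> real^'n \<Rightarrow> real^'m \<Rightarrow> real) \<Rightarrow> real^'n \<Rightarrow> bool" where
  "LICQ h x \<longleftrightarrow>
     (\<forall>y\<in>feasible h x.
        inj_on (\<lambda>i. grad (h i x) y) (active h x y) \<and>
        independent ((\<lambda>i. grad (h i x) y) ` active h x y))"

definition SCSC ::
  "(real^'n \<Rightarrow> real^'m \<Rightarrow> real) \<Rightarrow> ('k::finite \<Rightarrow> real^'n \<Rightarrow> real^'m \<Rightarrow> real) \<Rightarrow> real^'n \<Rightarrow> bool"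
  where
  "SCSC g h x \<longleftrightarrow>
     (\<forall>y l. KKT_pair g h x y l \<longrightarrow>
        (\<forall>i. (h i x y < 0 \<and> l $ i = 0) \<or> (h i x y = 0 \<and> l $ i > 0)))"

section \<open>The KKT matrix\<close>

text \<open>
  The size \<open>m + |J|\<close> of the KKT matrix depends on the active set \<open>J\<close> of the point, so the matrix
  is given by its entries, with rows and columns indexed by the finite set \<open>UNIV <+> J\<close> (the
  coordinates of \<open>y\<close>, then the active constraints); entries outside this set are irrelevant.
  \<open>nonsingular_on I A\<close> is the library's \<^const>\<open>invertible\<close> for the square matrix
  \<open>A\<close> over the index set \<open>I\<close>.
\<close>

fun KKT_matrix ::
  "(real^'n \<Rightarrow> real^'m \<Rightarrow> real) \<Rightarrow> ('k::finite \<Rightarrow> real^'n \<Rightarrow> real^'m \<Rightarrow> real) \<Rightarrow> real^'n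
    \<Rightarrow> real^'m \<Rightarrow> real^'k \<Rightarrow> 'm + 'k \<Rightarrow> 'm + 'k \<Rightarrow> real" where
  "KKT_matrix g h x y l (Inl a) (Inl b) = hess (\<lambda>z. Lagrangian g h x z l) y $ a $ b"
| "KKT_matrix g h x y l (Inl a) (Inr j) = grad (h j x) y $ a"
| "KKT_matrix g h x y l (Inr j) (Inl b) = grad (h j x) y $ b"
| "KKT_matrix g h x y l (Inr i) (Inr j) = 0"

definition nonsingular_on :: "'i set \<Rightarrow> ('i \<Rightarrow> 'i \<Rightarrow> real) \<Rightarrow> bool" where
  "nonsingular_on I A \<longleftrightarrow>
     (\<exists>B. \<forall>i\<in>I. \<forall>j\<in>I.
        (\<Sum>l\<in>I. A i l * B l j) = (if i = j then 1 else 0) \<and>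
        (\<Sum>l\<in>I. B i l * A l j) = (if i = j then 1 else 0))"

definition KKT_nondegenerate ::
  "(real^'n \<Rightarrow> real^'m \<Rightarrow> real) \<Rightarrow> ('k::finite \<Rightarrow> real^'n \<Rightarrow> real^'m \<Rightarrow> real) \<Rightarrow> real^'n \<Rightarrow> bool"
  where
  "KKT_nondegenerate g h x \<longleftrightarrow>
     (\<forall>y l. KKT_pair g h x y l \<longrightarrow>
        nonsingular_on (UNIV <+> active h x y) (KKT_matrix g h x y l))"

section \<open>Perturbations\<close>

definition perturb_obj ::
  "(real^'n \<Rightarrow> real^'m \<Rightarrow> real) \<Rightarrow> (real^'n \<Rightarrow> real^'m \<Rightarrow> real) \<Rightarrow> real^'n \<Rightarrow> real^'m \<Rightarrow> real"
  where "perturb_obj g s x y = g x y + s x y"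

definition perturb_con ::
  "('k \<Rightarrow> real^'n \<Rightarrow> real^'m \<Rightarrow> real) \<Rightarrow> ('k \<Rightarrow> real^'n \<Rightarrow> real^'m \<Rightarrow> real)
    \<Rightarrow> 'k \<Rightarrow> real^'n \<Rightarrow> real^'m \<Rightarrow> real"
  where "perturb_con h r i x y = h i x y + r i x y"

end

theory Submission
  imports Defs
begin

text \<open>
  Argue by contradiction with perturbations tending to \<open>0\<close> in \<open>C\<^sup>2\<close>. If local minimizers
  \<open>p\<^sub>n\<close> of the perturbed problems converge to \<open>y\<close>, LICQ makes their multipliers converge, so \<open>y\<close> is
  a KKT point; strict complementarity makes the active sets agree eventually; and the second-order
  necessary conditions pass to the limit, where nonsingularity of the KKT matrix upgrades
  semidefiniteness of the Lagrangian Hessian on the tangent space to definiteness. Definiteness gives a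
  growth estimate that is uniform in the perturbation: it shows that \<open>y\<close> is a strict local minimizer
  of the original problem and that at most one perturbed local minimizer lies near \<open>y\<close>. Existence of
  one needs no implicit function theorem: minimize the perturbed objective over the feasible points of
  a small closed ball about \<open>y\<close>; strictness keeps the minimizer off the sphere.
\<close>

section \<open>Coercive and dual families of vectors\<close>

text \<open>Every estimate must be uniform over all small perturbations. Negating one yields a bad
  perturbation for each radius 1/(n+1), so uniformity becomes a limit statement about sequences and
  no threshold is computed. The price is that objective, constraints, base point and multiplier all
  move with n; the central facts are therefore stated along sequences, with the unperturbed problem
  as the constant case. Bare linear independence gives no bound that survives a limit. LICQ is
  therefore carried by two quantitative properties: a lower bound on linear combinations, stable
  under small changes of the gradients and under dropping indices, and a biorthogonal family, which
  supplies directions with prescribed slopes along the active constraints. Passing from one to the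
  other transfers bounds to the perturbed gradients. The count runs over \<open>K_in\<close>, which
  lies in the open set where the perturbations are controlled: perturbed minimizers in
  \<open>K_in\<close> accumulate where the C2 analysis applies, and every original minimizer has a
  ball inside \<open>K_in\<close>.\<close>

lemma span_image_sum:
  fixes a :: "'i \<Rightarrow> 'v::real_vector"
  assumes "finite I" "p \<in> span (a ` I)"
  shows "\<exists>u. p = (\<Sum>i\<in>I. u i *\<^sub>R a i)"
  using assms(2)
proof (induction rule: span_induct_alt)
  case base
  show ?case by (rule exI[of _ "\<lambda>_. 0"]) simp
next
  case (step c v q)
  then obtain k u where k: "k \<in> I" "v = a k" and u: "q = (\<Sum>i\<in>I. u i *\<^sub>R a i)" by blast
  have "(\<Sum>i\<in>I. ((if i = k then c else 0) + u i) *\<^sub>R a i) = c *\<^sub>R v + q"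
    using k assms(1) by (simp add: scaleR_add_left sum.distrib u if_distrib[of "\<lambda>t. t *\<^sub>R _"] sum.delta cong: if_cong)
  then show ?case by metis
qed

text \<open>Quantitative linear independence, with content only for \<open>c > 0\<close>. Measuring
  the coefficients by the sum of their absolute values makes a uniform error in the vectors cost
  exactly that error in \<open>c\<close>.\<close>

definition coercive_family :: "real \<Rightarrow> 'i set \<Rightarrow> ('i \<Rightarrow> 'v::real_normed_vector) \<Rightarrow> bool" where
  "coercive_family c J a \<longleftrightarrow> (\<forall>l. c * (\<Sum>i\<in>J. \<bar>l i\<bar>) \<le> norm (\<Sum>i\<in>J. l i *\<^sub>R a i))"

definition dual_family :: "'i set \<Rightarrow> ('i \<Rightarrow> 'v::real_inner) \<Rightarrow> ('i \<Rightarrow> 'v) \<Rightarrow> bool" where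
  "dual_family J a e \<longleftrightarrow> (\<forall>i\<in>J. \<forall>j\<in>J. a i \<bullet> e j = (if i = j then 1 else 0))"

text \<open>The component \<open>z\<close> of \<open>a j\<close> orthogonal to the other vectors,
  rescaled, is the dual vector. The decomposition is exposed because the norm of the dual vector is
  the reciprocal of the norm of \<open>z\<close>.\<close>

lemma dual_vector:
  fixes a :: "'i \<Rightarrow> 'v::euclidean_space"
  assumes "j \<in> J" "a j \<notin> span (a ` (J - {j}))"
  obtains p z where "p \<in> span (a ` (J - {j}))" "z = a j - p" "z \<noteq> 0"
    "\<And>i. i \<in> J \<Longrightarrow> a i \<bullet> (z /\<^sub>R (z \<bullet> z)) = (if i = j then 1 else 0)"
proof -
  obtain p z where pz: "p \<in> span (a ` (J - {j}))"
    "\<And>w. w \<in> span (a ` (J - {j})) \<Longrightarrow> orthogonal z w" "a j = p + z"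
    using orthogonal_subspace_decomp_exists[of "a ` (J - {j})" "a j"] by metis
  have "z \<noteq> 0" using pz assms by auto
  moreover have "a i \<bullet> (z /\<^sub>R (z \<bullet> z)) = (if i = j then 1 else 0)" if "i \<in> J" for i
  proof (cases "i = j")
    case True
    have "p \<bullet> z = 0" using pz(1,2) by (metis orthogonal_def inner_commute)
    then show ?thesis using True pz(3) \<open>z \<noteq> 0\<close> by (simp add: inner_add_left)
  next
    case False
    then have "a i \<bullet> z = 0"
      using pz(2)[of "a i"] that by (simp add: orthogonal_def inner_commute span_base)
    then show ?thesis using False by simp
  qed
  ultimately show ?thesis using that[of p z] pz by (auto simp: algebra_simps)
qed

text \<open>In \<open>a j - p\<close> with \<open>p\<close> in the span of the others, the
  coefficient of \<open>a j\<close> is 1, so coercivity keeps \<open>a j\<close> at distance at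
  least \<open>c\<close> from that span; the dual vector has the reciprocal of this distance as its
  norm. The bound matters: it is uniform along sequences of families with the same
  \<open>c\<close>.\<close>

lemma coercive_family_dual:
  fixes a :: "'i \<Rightarrow> 'v::euclidean_space"
  assumes "finite J" "c > 0" and c: "coercive_family c J a"
  obtains e where "dual_family J a e" "\<And>j. j \<in> J \<Longrightarrow> norm (e j) \<le> 1 / c"
proof -
  have "\<exists>v. (\<forall>i\<in>J. a i \<bullet> v = (if i = j then 1 else 0)) \<and> norm v \<le> 1 / c" if j: "j \<in> J" for j
  proof -
    have low: "c \<le> norm (a j - p)" if "p \<in> span (a ` (J - {j}))" for p
    proof -
      obtain u where u: "p = (\<Sum>i\<in>J-{j}. u i *\<^sub>R a i)"
        using span_image_sum[OF _ \<open>p \<in> _\<close>] assms(1) by auto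
      define l where "l i = (if i = j then 1 else - u i)" for i
      have "(\<Sum>i\<in>J. l i *\<^sub>R a i) = a j - p"
        using j assms(1) by (simp add: sum.remove[of J j] l_def u sum_negf)
      moreover have "\<bar>l j\<bar> \<le> (\<Sum>i\<in>J. \<bar>l i\<bar>)"
        using j assms(1) by (intro member_le_sum) auto
      then have "c * 1 \<le> c * (\<Sum>i\<in>J. \<bar>l i\<bar>)"
        using assms(2) by (intro mult_left_mono) (auto simp: l_def)
      ultimately show ?thesis using c unfolding coercive_family_def by (metis mult_1_right order_trans)
    qed
    then have "a j \<notin> span (a ` (J - {j}))" using assms(2) by fastforce
    then obtain p z where pz: "p \<in> span (a ` (J - {j}))" "z = a j - p" "z \<noteq> 0"
      "\<And>i. i \<in> J \<Longrightarrow> a i \<bullet> (z /\<^sub>R (z \<bullet> z)) = (if i = j then 1 else 0)"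
      using dual_vector[OF j] by blast
    have "norm (z /\<^sub>R (z \<bullet> z)) = 1 / norm z"
      using pz(3) by (simp add: dot_square_norm power2_eq_square divide_simps)
    also have "\<dots> \<le> 1 / c" using low[OF pz(1)] pz(2) assms(2) by (simp add: frac_le)
    finally show ?thesis using pz(4) by blast
  qed
  then show ?thesis using that unfolding dual_family_def by metis
qed

lemma dual_family_coercive:
  fixes a :: "'i \<Rightarrow> 'v::real_inner"
  assumes "finite J" and e: "dual_family J a e"
  shows "\<exists>c>0. coercive_family c J a"
proof -
  \<comment> \<open>The summand 1 keeps \<open>S\<close> positive when \<open>J\<close> is empty or
    all \<open>e j\<close> vanish.\<close>
  define S where "S = 1 + (\<Sum>j\<in>J. norm (e j))"
  have S: "S > 0" unfolding S_def by (simp add: add_pos_nonneg sum_nonneg)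
  have "(\<Sum>i\<in>J. \<bar>l i\<bar>) \<le> S * norm (\<Sum>i\<in>J. l i *\<^sub>R a i)" for l
  proof -
    let ?v = "\<Sum>i\<in>J. l i *\<^sub>R a i"
    have "\<bar>l j\<bar> \<le> norm ?v * norm (e j)" if "j \<in> J" for j
    proof -
      have "?v \<bullet> e j = (\<Sum>i\<in>J. l i * (if i = j then 1 else 0))"
        using e that by (auto simp: inner_sum_left dual_family_def intro!: sum.cong)
      also have "\<dots> = l j" using assms(1) that by (simp add: if_distrib cong: if_cong)
      finally show ?thesis using Cauchy_Schwarz_ineq2[of ?v "e j"] by simp
    qed
    then have "(\<Sum>i\<in>J. \<bar>l i\<bar>) \<le> (\<Sum>j\<in>J. norm ?v * norm (e j))" by (rule sum_mono)
    also have "\<dots> \<le> S * norm ?v"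
      unfolding S_def sum_distrib_left[symmetric] by (simp add: algebra_simps)
    finally show ?thesis .
  qed
  then have "coercive_family (1 / S) J a" unfolding coercive_family_def
    using S by (simp add: divide_simps mult.commute)
  then show ?thesis using S by (intro exI[of _ "1/S"]) simp
qed

text \<open>Injectivity makes removing the index \<open>j\<close> the same as removing the vector
  \<open>a j\<close>; otherwise a repeated gradient would remain in the span.\<close>

lemma independent_family_dual:
  fixes a :: "'i \<Rightarrow> 'v::euclidean_space"
  assumes "inj_on a J" "independent (a ` J)"
  obtains e where "dual_family J a e"
proof -
  have "\<exists>v. \<forall>i\<in>J. a i \<bullet> v = (if i = j then 1 else 0)" if j: "j \<in> J" for j
  proof -
    have "a ` J - {a j} = a ` (J - {j})" using assms(1) j by (auto simp: inj_on_def)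
    then have "a j \<notin> span (a ` (J - {j}))"
      using assms(2) j unfolding dependent_def by force
    then show ?thesis using dual_vector[OF j] by metis
  qed
  then show ?thesis using that unfolding dual_family_def by metis
qed

lemma coercive_family_perturb:
  fixes a b :: "'i \<Rightarrow> 'v::real_normed_vector"
  assumes "coercive_family c J a" "\<And>i. i \<in> J \<Longrightarrow> norm (b i - a i) \<le> \<eta>"
  shows "coercive_family (c - \<eta>) J b"
  unfolding coercive_family_def
proof
  fix l :: "'i \<Rightarrow> real"
  have "norm (\<Sum>i\<in>J. l i *\<^sub>R (b i - a i)) \<le> (\<Sum>i\<in>J. \<bar>l i\<bar>) * \<eta>"
    unfolding sum_distrib_right by (rule sum_norm_le) (simp add: assms(2) mult_left_mono)
  moreover have "(\<Sum>i\<in>J. l i *\<^sub>R b i) = (\<Sum>i\<in>J. l i *\<^sub>R a i) + (\<Sum>i\<in>J. l i *\<^sub>R (b i - a i))"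
    by (simp add: scaleR_diff_right sum_subtractf)
  then have "norm (\<Sum>i\<in>J. l i *\<^sub>R a i) - norm (\<Sum>i\<in>J. l i *\<^sub>R (b i - a i)) \<le> norm (\<Sum>i\<in>J. l i *\<^sub>R b i)"
    by (metis norm_diff_ineq)
  moreover have "c * (\<Sum>i\<in>J. \<bar>l i\<bar>) \<le> norm (\<Sum>i\<in>J. l i *\<^sub>R a i)"
    using assms(1) unfolding coercive_family_def by blast
  ultimately show "(c - \<eta>) * (\<Sum>i\<in>J. \<bar>l i\<bar>) \<le> norm (\<Sum>i\<in>J. l i *\<^sub>R b i)"
    by (simp add: left_diff_distrib mult.commute)
qed

text \<open>Extend the coefficients by 0. This serves perturbed active sets, which a priori may be
  smaller than the active set at the limit point.\<close>

lemma coercive_family_subset: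
  assumes "coercive_family c J a" "I \<subseteq> J" "finite J"
  shows "coercive_family c I a"
  unfolding coercive_family_def
proof
  fix l :: "_ \<Rightarrow> real"
  let ?l = "\<lambda>i. if i \<in> I then l i else 0"
  have "(\<Sum>i\<in>J. ?l i *\<^sub>R a i) = (\<Sum>i\<in>I. l i *\<^sub>R a i)" "(\<Sum>i\<in>J. \<bar>?l i\<bar>) = (\<Sum>i\<in>I. \<bar>l i\<bar>)"
    using assms(2,3) by (auto intro!: sum.mono_neutral_cong_right)
  then show "c * (\<Sum>i\<in>I. \<bar>l i\<bar>) \<le> norm (\<Sum>i\<in>I. l i *\<^sub>R a i)"
    using assms(1) unfolding coercive_family_def by metis
qed

lemma dual_family_sum:
  assumes "finite J" "dual_family J a e" "i \<in> J"
  shows "a i \<bullet> (\<Sum>j\<in>J. u j *\<^sub>R e j) = u i"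
proof -
  have "a i \<bullet> (\<Sum>j\<in>J. u j *\<^sub>R e j) = (\<Sum>j\<in>J. u j * (if i = j then 1 else 0))"
    using assms by (auto simp: inner_sum_right dual_family_def intro!: sum.cong)
  then show ?thesis using assms by (simp add: if_distrib cong: if_cong)
qed

text \<open>Subtracting from any \<open>d\<close> its components along the \<open>e j\<close> leaves
  a vector annihilated by all \<open>a i\<close>, hence by \<open>G\<close>. This is the multiplier
  rule in linear form: it produces the coefficients explicitly as
  \<open>G \<bullet> e j\<close>.\<close>

lemma dual_family_combination:
  fixes G :: "'v::real_inner"
  assumes "finite J" and e: "dual_family J a e"
    and G: "\<And>d. (\<And>i. i \<in> J \<Longrightarrow> a i \<bullet> d = 0) \<Longrightarrow> G \<bullet> d = 0"
  shows "G = (\<Sum>j\<in>J. (G \<bullet> e j) *\<^sub>R a j)"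
proof -
  have "G \<bullet> d = (\<Sum>j\<in>J. (G \<bullet> e j) *\<^sub>R a j) \<bullet> d" for d
  proof -
    let ?d = "d - (\<Sum>j\<in>J. (a j \<bullet> d) *\<^sub>R e j)"
    have "G \<bullet> ?d = 0"
      using dual_family_sum[OF assms(1) e, of _ "\<lambda>j. a j \<bullet> d"] by (intro G) (simp add: inner_diff_right)
    then show ?thesis
      by (simp add: inner_diff_right inner_sum_right inner_sum_left mult.commute)
  qed
  then show ?thesis by (metis vector_eq_rdot)
qed

section \<open>Second-order calculus\<close>

lemma tendsto_matrix_vector_mult [tendsto_intros]:
  fixes A :: "'a \<Rightarrow> real^'m^'k"
  assumes "(A \<longlongrightarrow> B) F" "(v \<longlongrightarrow> w) F"
  shows "((\<lambda>n. A n *v v n) \<longlongrightarrow> B *v w) F"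
  by (rule vec_tendstoI)
    (auto simp: matrix_vector_mult_def intro!: tendsto_intros tendsto_vec_nth assms)

text \<open>Where no witness exists, \<open>\<xi> t\<close> is an arbitrary value; only eventual
  statements about it are meaningful.\<close>

lemma eventually_choice:
  assumes "eventually (\<lambda>t. \<exists>x. P t x) F"
  obtains \<xi> where "eventually (\<lambda>t. P t (\<xi> t)) F"
proof
  show "eventually (\<lambda>t. P t (SOME x. P t x)) F"
    using assms by (rule eventually_mono) (rule someI_ex[of "P _"])
qed

lemma grad_unique:
  assumes "(f has_derivative (\<lambda>v. G \<bullet> v)) (at y)"
  shows "grad f y = G"
  unfolding grad_def frechet_derivative_at[OF assms, symmetric]
  by (simp add: vec_eq_iff inner_axis)

lemma hess_unique:
  assumes "(grad f has_derivative (\<lambda>v. H *v v)) (at y)"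
  shows "hess f y = H"
  unfolding hess_def frechet_derivative_at[OF assms, symmetric]
  by (simp add: matrix_of_matrix_vector_mul)

text \<open>The derivatives are tied to \<open>grad\<close> and \<open>hess\<close> themselves, the
  functions in which \<open>C2_norm\<close> and the KKT conditions are expressed.\<close>

definition C2_on :: "(real^'m \<Rightarrow> real) \<Rightarrow> (real^'m) set \<Rightarrow> bool" where
  "C2_on f W \<longleftrightarrow> open W \<and> continuous_on W (hess f) \<and>
     (\<forall>y\<in>W. (f has_derivative (\<lambda>v. grad f y \<bullet> v)) (at y) \<and>
            (grad f has_derivative (\<lambda>v. hess f y *v v)) (at y))"

lemma C2_onI:
  assumes "open W" "continuous_on W H"
    and f: "\<And>y. y \<in> W \<Longrightarrow> (f has_derivative (\<lambda>v. G y \<bullet> v)) (at y)"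
    and G: "\<And>y. y \<in> W \<Longrightarrow> (G has_derivative (\<lambda>v. H y *v v)) (at y)"
  shows "C2_on f W" "\<And>y. y \<in> W \<Longrightarrow> grad f y = G y" "\<And>y. y \<in> W \<Longrightarrow> hess f y = H y"
proof -
  show grad: "grad f y = G y" if "y \<in> W" for y
    using grad_unique[OF f] that by blast
  have der: "(grad f has_derivative (\<lambda>v. H y *v v)) (at y)" if "y \<in> W" for y
    using has_derivative_transform_within_open[OF G assms(1)] that grad by metis
  show hess: "hess f y = H y" if "y \<in> W" for y
    using hess_unique[OF der] that by blast
  show "C2_on f W"
    unfolding C2_on_def using assms(1,2) f der grad hess by (simp cong: continuous_on_cong)
qed

lemma C2_on_D:
  assumes "C2_on f W"
  shows "open W" "continuous_on W f" "continuous_on W (grad f)" "continuous_on W (hess f)"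
    and "\<And>y. y \<in> W \<Longrightarrow> (f has_derivative (\<lambda>v. grad f y \<bullet> v)) (at y)"
    and "\<And>y. y \<in> W \<Longrightarrow> (grad f has_derivative (\<lambda>v. hess f y *v v)) (at y)"
  using assms unfolding C2_on_def
  by (auto intro!: continuous_at_imp_continuous_on dest: has_derivative_continuous)

lemma C2_on_subset: "C2_on f W \<Longrightarrow> open V \<Longrightarrow> V \<subseteq> W \<Longrightarrow> C2_on f V"
  unfolding C2_on_def by (auto intro: continuous_on_subset)

lemma C2_on_add:
  assumes "C2_on f W" "C2_on g W"
  shows "C2_on (\<lambda>y. f y + g y) W"
    and "\<And>y. y \<in> W \<Longrightarrow> grad (\<lambda>y. f y + g y) y = grad f y + grad g y"
    and "\<And>y. y \<in> W \<Longrightarrow> hess (\<lambda>y. f y + g y) y = hess f y + hess g y"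
  by (rule C2_onI[where H = "\<lambda>y. hess f y + hess g y" and G = "\<lambda>y. grad f y + grad g y"],
      use assms in \<open>auto simp: C2_on_D matrix_vector_mult_add_rdistrib inner_add_left
        intro!: continuous_on_add has_derivative_add\<close>)+

lemma sum_matrix_vector_mult:
  "(\<Sum>i\<in>I. c i *\<^sub>R A i) *v v = (\<Sum>i\<in>I. c i *\<^sub>R (A i *v v))"
  for A :: "'i \<Rightarrow> real^'m^'k"
  by (induction I rule: infinite_finite_induct)
    (simp_all add: matrix_vector_mult_add_rdistrib scaleR_matrix_vector_assoc)

lemma C2_on_lagrangian:
  fixes h :: "'k \<Rightarrow> real^'m \<Rightarrow> real"
  assumes f: "C2_on f W" and h: "\<And>i. C2_on (h i) W"
  shows "C2_on (\<lambda>y. f y + (\<Sum>i\<in>I. l i * h i y)) W"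
    and "\<And>y. y \<in> W \<Longrightarrow> grad (\<lambda>y. f y + (\<Sum>i\<in>I. l i * h i y)) y = grad f y + (\<Sum>i\<in>I. l i *\<^sub>R grad (h i) y)"
    and "\<And>y. y \<in> W \<Longrightarrow> hess (\<lambda>y. f y + (\<Sum>i\<in>I. l i * h i y)) y = hess f y + (\<Sum>i\<in>I. l i *\<^sub>R hess (h i) y)"
proof -
  have *: "open W" "continuous_on W (\<lambda>y. hess f y + (\<Sum>i\<in>I. l i *\<^sub>R hess (h i) y))"
    by (auto simp: C2_on_D[OF f] C2_on_D[OF h] intro!: continuous_intros)
  have 1: "((\<lambda>y. f y + (\<Sum>i\<in>I. l i * h i y)) has_derivative
      (\<lambda>v. (grad f y + (\<Sum>i\<in>I. l i *\<^sub>R grad (h i) y)) \<bullet> v)) (at y)" if "y \<in> W" for y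
    unfolding inner_add_left inner_sum_left inner_scaleR_left
    by (intro has_derivative_add has_derivative_sum has_derivative_mult_right
        C2_on_D(5)[OF f] C2_on_D(5)[OF h] that)
  have 2: "((\<lambda>y. grad f y + (\<Sum>i\<in>I. l i *\<^sub>R grad (h i) y)) has_derivative
      (\<lambda>v. (hess f y + (\<Sum>i\<in>I. l i *\<^sub>R hess (h i) y)) *v v)) (at y)" if "y \<in> W" for y
    unfolding matrix_vector_mult_add_rdistrib sum_matrix_vector_mult
    by (intro has_derivative_add has_derivative_sum has_derivative_scaleR_right
        C2_on_D(6)[OF f] C2_on_D(6)[OF h] that)
  note C2_onI[OF * 1 2]
  then show "C2_on (\<lambda>y. f y + (\<Sum>i\<in>I. l i * h i y)) W"
    "\<And>y. y \<in> W \<Longrightarrow> grad (\<lambda>y. f y + (\<Sum>i\<in>I. l i * h i y)) y = grad f y + (\<Sum>i\<in>I. l i *\<^sub>R grad (h i) y)"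
    "\<And>y. y \<in> W \<Longrightarrow> hess (\<lambda>y. f y + (\<Sum>i\<in>I. l i * h i y)) y = hess f y + (\<Sum>i\<in>I. l i *\<^sub>R hess (h i) y)"
    by auto
qed

lemma line_derivative:
  assumes "C2_on f W" "y + t *\<^sub>R d \<in> W"
  shows "((\<lambda>t. f (y + t *\<^sub>R d)) has_real_derivative grad f (y + t *\<^sub>R d) \<bullet> d) (at t)"
proof -
  have "((\<lambda>t. f (y + t *\<^sub>R d)) has_derivative (\<lambda>s. grad f (y + t *\<^sub>R d) \<bullet> (s *\<^sub>R d))) (at t)"
    by (rule has_derivative_compose[where f = "\<lambda>t. y + t *\<^sub>R d" and g = "f" and f' = "\<lambda>s. s *\<^sub>R d"])
      (use C2_on_D(5)[OF assms] in \<open>auto intro!: derivative_eq_intros\<close>)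
  then show ?thesis by (simp add: has_field_derivative_def mult_commute_abs)
qed

lemma line_derivative_grad:
  assumes "C2_on f W" "y + t *\<^sub>R d \<in> W"
  shows "((\<lambda>t. grad f (y + t *\<^sub>R d) \<bullet> u) has_real_derivative (hess f (y + t *\<^sub>R d) *v d) \<bullet> u) (at t)"
proof -
  have "((\<lambda>t. grad f (y + t *\<^sub>R d)) has_derivative (\<lambda>s. hess f (y + t *\<^sub>R d) *v (s *\<^sub>R d))) (at t)"
    by (rule has_derivative_compose[where f = "\<lambda>t. y + t *\<^sub>R d" and g = "grad f" and f' = "\<lambda>s. s *\<^sub>R d"])
      (use C2_on_D(6)[OF assms] in \<open>auto intro!: derivative_eq_intros\<close>)
  from has_derivative_inner_left[OF this, of u] show ?thesis
    by (simp add: has_field_derivative_def mult_commute_abs matrix_vector_mult_scaleR)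
qed

lemma taylor_second_order:
  assumes f: "C2_on f W" and seg: "closed_segment y z \<subseteq> W"
  shows "\<exists>\<xi>\<in>closed_segment y z.
    f z = f y + grad f y \<bullet> (z - y) + (z - y) \<bullet> (hess f \<xi> *v (z - y)) / 2"
proof -
  let ?d = "z - y"
  have W: "y + t *\<^sub>R ?d \<in> closed_segment y z" if "0 \<le> t" "t \<le> 1" for t
    using that by (auto simp: in_segment algebra_simps)
  \<comment> \<open>\<open>D m\<close> is the m-th derivative along the segment for m up to 2,
    packaged as the indexed family that \<open>Taylor_up\<close> expects.\<close>
  define D where "D m t = (if m = 0 then f (y + t *\<^sub>R ?d) else if m = Suc 0 then grad f (y + t *\<^sub>R ?d) \<bullet> ?d
    else (hess f (y + t *\<^sub>R ?d) *v ?d) \<bullet> ?d)" for m :: nat and t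
  have "\<exists>t. 0 < t \<and> t < 1 \<and> D 0 1 = (\<Sum>m<2. D m 0 / fact m * (1 - 0) ^ m) + D 2 t / fact 2 * (1 - 0) ^ 2"
  proof (rule Taylor_up[where a=0])
    show "\<forall>m t. m < 2 \<and> 0 \<le> t \<and> t \<le> 1 \<longrightarrow> (D m has_real_derivative D (Suc m) t) (at t)"
    proof clarify
      fix m :: nat and t :: real
      assume "m < 2" and t: "0 \<le> t" "t \<le> 1"
      then consider "m = 0" | "m = Suc 0" by linarith
      then show "(D m has_real_derivative D (Suc m) t) (at t)"
        using line_derivative[OF f, of y t ?d] line_derivative_grad[OF f, of y t ?d ?d] W[OF t] seg
        by cases (auto simp: D_def[abs_def])
    qed
  qed auto
  then obtain t where t: "0 < t" "t < 1" "D 0 1 = D 0 0 + D (Suc 0) 0 + D 2 t / 2"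
    by (auto simp: numeral_2_eq_2)
  then show ?thesis using W[of t]
    by (intro bexI[of _ "y + t *\<^sub>R ?d"]) (auto simp: D_def inner_commute)
qed

text \<open>Both orders of differentiation are limits of the same second difference.\<close>

lemma hess_symmetric:
  assumes f: "C2_on f W" and y: "y \<in> W"
  shows "u \<bullet> (hess f y *v v) = v \<bullet> (hess f y *v u)"
proof -
  define \<Delta> where "\<Delta> u v t = f (y + t *\<^sub>R u + t *\<^sub>R v) - f (y + t *\<^sub>R u) - f (y + t *\<^sub>R v) + f y" for u v t
  have lim: "((\<lambda>t. \<Delta> u v t / t\<^sup>2) \<longlongrightarrow> u \<bullet> (hess f y *v v)) (at_right 0)" for u v
  proof -
    obtain r where r: "r > 0" "ball y r \<subseteq> W"
      using C2_on_D(1)[OF f] y openE by blast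
    have "((\<lambda>t. t * (norm u + norm v)) \<longlongrightarrow> 0 * (norm u + norm v)) (at_right 0)"
      by (intro tendsto_intros)
    then have "eventually (\<lambda>t. t * (norm u + norm v) < r) (at_right 0)"
      using r(1) by (intro order_tendstoD(2)) auto
    moreover have "eventually (\<lambda>t::real. t > 0) (at_right 0)"
      by (rule eventually_at_right_less)
    ultimately have "eventually (\<lambda>t. \<exists>\<xi>. norm (\<xi> - y) \<le> t * (norm u + norm v) \<and> \<Delta> u v t / t\<^sup>2 = u \<bullet> (hess f \<xi> *v v)) (at_right 0)"
    proof eventually_elim
      case (elim t)
      \<comment> \<open>The whole parallelogram with coefficients in [0, t] stays in
        \<open>W\<close> and shrinks to \<open>y\<close>; both mean value arguments take place
        inside it.\<close>
      have inW: "y + a *\<^sub>R u + b *\<^sub>R v \<in> W" and near: "norm (a *\<^sub>R u + b *\<^sub>R v) \<le> t * (norm u + norm v)"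
        if "0 \<le> a" "a \<le> t" "0 \<le> b" "b \<le> t" for a b
      proof -
        have "norm (a *\<^sub>R u + b *\<^sub>R v) \<le> a * norm u + b * norm v"
          using norm_triangle_ineq[of "a *\<^sub>R u" "b *\<^sub>R v"] that by simp
        also have "\<dots> \<le> t * (norm u + norm v)"
          using that by (simp add: distrib_left add_mono mult_right_mono)
        finally show n: "norm (a *\<^sub>R u + b *\<^sub>R v) \<le> t * (norm u + norm v)" .
        have "dist y (y + a *\<^sub>R u + b *\<^sub>R v) = norm (a *\<^sub>R u + b *\<^sub>R v)"
          unfolding dist_commute[of y] by (simp add: dist_norm add.assoc)
        then have "dist y (y + a *\<^sub>R u + b *\<^sub>R v) < r" using n elim(1) by simp
        then show "y + a *\<^sub>R u + b *\<^sub>R v \<in> W" using r(2) by auto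
      qed
      \<comment> \<open>The second difference is an increment in \<open>u\<close> of a function that
        is itself an increment in \<open>v\<close>. One mean value in each direction leaves a single
        Hessian entry at a nearby point.\<close>
      have "((\<lambda>a. f (y + t *\<^sub>R v + a *\<^sub>R u) - f (y + a *\<^sub>R u)) has_real_derivative
          grad f (y + t *\<^sub>R v + a *\<^sub>R u) \<bullet> u - grad f (y + a *\<^sub>R u) \<bullet> u) (at a)"
        if "0 \<le> a" "a \<le> t" for a
        using inW[of a t] inW[of a 0] that
        by (intro DERIV_diff line_derivative[OF f]) (auto simp: add_ac)
      from MVT2[OF elim(2) this] obtain a where a: "0 < a" "a < t"
        "\<Delta> u v t = t * (grad f (y + t *\<^sub>R v + a *\<^sub>R u) \<bullet> u - grad f (y + a *\<^sub>R u) \<bullet> u)"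
        unfolding \<Delta>_def by (auto simp: add_ac)
      have "((\<lambda>b. grad f (y + a *\<^sub>R u + b *\<^sub>R v) \<bullet> u) has_real_derivative
          (hess f (y + a *\<^sub>R u + b *\<^sub>R v) *v v) \<bullet> u) (at b)" if "0 \<le> b" "b \<le> t" for b
        using inW[of a b] a that by (intro line_derivative_grad[OF f]) auto
      from MVT2[OF elim(2) this] obtain b where b: "0 < b" "b < t"
        "grad f (y + a *\<^sub>R u + t *\<^sub>R v) \<bullet> u - grad f (y + a *\<^sub>R u) \<bullet> u
          = t * ((hess f (y + a *\<^sub>R u + b *\<^sub>R v) *v v) \<bullet> u)"
        by auto
      have swap: "y + t *\<^sub>R v + a *\<^sub>R u = y + a *\<^sub>R u + t *\<^sub>R v" by (simp add: add_ac)
      have "\<Delta> u v t / t\<^sup>2 = u \<bullet> (hess f (y + a *\<^sub>R u + b *\<^sub>R v) *v v)"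
        using elim(2) unfolding a(3)[unfolded swap b(3)] by (simp add: power2_eq_square inner_commute)
      moreover have "norm (y + a *\<^sub>R u + b *\<^sub>R v - y) \<le> t * (norm u + norm v)"
        using near[of a b] a b by (simp add: add.assoc)
      ultimately show ?case by blast
    qed
    then obtain \<xi> where ev: "eventually (\<lambda>t. norm (\<xi> t - y) \<le> t * (norm u + norm v) \<and> \<Delta> u v t / t\<^sup>2 = u \<bullet> (hess f (\<xi> t) *v v)) (at_right 0)"
      by (rule eventually_choice)
    have "((\<lambda>t. t * (norm u + norm v)) \<longlongrightarrow> 0) (at_right 0)"
      by (auto intro!: tendsto_eq_intros)
    then have "((\<lambda>t. \<xi> t - y) \<longlongrightarrow> 0) (at_right 0)"
      by (rule Lim_null_comparison[OF eventually_mono[OF ev], rotated]) simp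
    then have "(\<xi> \<longlongrightarrow> y) (at_right 0)" by (simp add: LIM_zero_iff)
    moreover have "isCont (hess f) y"
      using C2_on_D(1,4)[OF f] y by (simp add: continuous_on_eq_continuous_at)
    ultimately have "((\<lambda>t. hess f (\<xi> t)) \<longlongrightarrow> hess f y) (at_right 0)"
      by (simp add: isCont_tendsto_compose)
    then have "((\<lambda>t. u \<bullet> (hess f (\<xi> t) *v v)) \<longlongrightarrow> u \<bullet> (hess f y *v v)) (at_right 0)"
      by (intro tendsto_intros)
    then show ?thesis
      by (rule Lim_transform_eventually) (rule eventually_mono[OF ev], simp)
  qed
  have "f (y + t *\<^sub>R v + t *\<^sub>R u) = f (y + t *\<^sub>R u + t *\<^sub>R v)" for t by (simp add: add_ac)
  then have "\<Delta> v u t = \<Delta> u v t" for t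
    unfolding \<Delta>_def by simp
  then have "((\<lambda>t. \<Delta> u v t / t\<^sup>2) \<longlongrightarrow> v \<bullet> (hess f y *v u)) (at_right 0)"
    using lim[of v u] by presburger
  then show ?thesis
    by (rule tendsto_unique[OF trivial_limit_at_right_real lim[of u v]])
qed

text \<open>The displacement along \<open>e\<close> already has order t^2, so it enters the
  quadratic coefficient through the gradient alone; its Hessian terms have order t^3 or higher. Thus
  \<open>e\<close> can shift that coefficient freely wherever the gradient does not vanish.\<close>

lemma taylor_parabola:
  assumes f: "C2_on f W" and y: "y \<in> W"
  shows "((\<lambda>t. (f (y + t *\<^sub>R d + t\<^sup>2 *\<^sub>R e) - f y - t * (grad f y \<bullet> d)) / t\<^sup>2)
     \<longlongrightarrow> grad f y \<bullet> e + d \<bullet> (hess f y *v d) / 2) (at_right 0)"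
proof -
  define w where "w t = t *\<^sub>R d + t\<^sup>2 *\<^sub>R e" for t :: real
  obtain r where r: "r > 0" "ball y r \<subseteq> W"
    using C2_on_D(1)[OF f] y openE by blast
  have "(w \<longlongrightarrow> 0 *\<^sub>R d + 0\<^sup>2 *\<^sub>R e) (at_right 0)"
    unfolding w_def by (intro tendsto_intros)
  then have w0: "((\<lambda>t. norm (w t)) \<longlongrightarrow> 0) (at_right 0)"
    by (intro tendsto_norm_zero) simp
  then have "eventually (\<lambda>t. norm (w t) < r) (at_right 0)"
    using r(1) by (rule order_tendstoD(2))
  then have "eventually (\<lambda>t. \<exists>\<xi>. norm (\<xi> - y) \<le> norm (w t) \<and>
      f (y + w t) = f y + grad f y \<bullet> w t + w t \<bullet> (hess f \<xi> *v w t) / 2) (at_right 0)"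
  proof eventually_elim
    case (elim t)
    have "closed_segment y (y + w t) \<subseteq> ball y r"
      using elim r(1) by (intro closed_segment_subset) (auto simp: dist_norm)
    then have "closed_segment y (y + w t) \<subseteq> W" using r(2) by blast
    from taylor_second_order[OF f this] obtain \<xi> where
      "\<xi> \<in> closed_segment y (y + w t)"
      "f (y + w t) = f y + grad f y \<bullet> w t + w t \<bullet> (hess f \<xi> *v w t) / 2" by auto
    then show ?case using segment_bound(1)[of \<xi> y "y + w t"] by auto
  qed
  then obtain \<xi> where ev: "eventually (\<lambda>t. norm (\<xi> t - y) \<le> norm (w t) \<and>
      f (y + w t) = f y + grad f y \<bullet> w t + w t \<bullet> (hess f (\<xi> t) *v w t) / 2) (at_right 0)"
    by (rule eventually_choice)
  have "((\<lambda>t. \<xi> t - y) \<longlongrightarrow> 0) (at_right 0)"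
    by (rule Lim_null_comparison[OF eventually_mono[OF ev] w0]) simp
  then have "(\<xi> \<longlongrightarrow> y) (at_right 0)" by (simp add: LIM_zero_iff)
  moreover have "isCont (hess f) y"
    using C2_on_D(1,4)[OF f] y by (simp add: continuous_on_eq_continuous_at)
  ultimately have H: "((\<lambda>t. hess f (\<xi> t)) \<longlongrightarrow> hess f y) (at_right 0)"
    by (simp add: isCont_tendsto_compose)
  have "((\<lambda>t. grad f y \<bullet> e + (d + t *\<^sub>R e) \<bullet> (hess f (\<xi> t) *v (d + t *\<^sub>R e)) / 2)
    \<longlongrightarrow> grad f y \<bullet> e + (d + 0 *\<^sub>R e) \<bullet> (hess f y *v (d + 0 *\<^sub>R e)) / 2) (at_right 0)"
    by (intro tendsto_intros H) auto
  then have "((\<lambda>t. grad f y \<bullet> e + (d + t *\<^sub>R e) \<bullet> (hess f (\<xi> t) *v (d + t *\<^sub>R e)) / 2)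
    \<longlongrightarrow> grad f y \<bullet> e + d \<bullet> (hess f y *v d) / 2) (at_right 0)" by simp
  then show ?thesis
  proof (rule Lim_transform_eventually)
    show "\<forall>\<^sub>F t in at_right 0. grad f y \<bullet> e + (d + t *\<^sub>R e) \<bullet> (hess f (\<xi> t) *v (d + t *\<^sub>R e)) / 2
      = (f (y + t *\<^sub>R d + t\<^sup>2 *\<^sub>R e) - f y - t * (grad f y \<bullet> d)) / t\<^sup>2"
      using ev eventually_at_right_less
    proof eventually_elim
      case (elim t)
      have w: "w t = t *\<^sub>R (d + t *\<^sub>R e)" unfolding w_def by (simp add: power2_eq_square algebra_simps)
      have "w t \<bullet> (hess f (\<xi> t) *v w t) = t\<^sup>2 * ((d + t *\<^sub>R e) \<bullet> (hess f (\<xi> t) *v (d + t *\<^sub>R e)))"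
        unfolding w by (simp add: matrix_vector_mult_scaleR power2_eq_square)
      moreover have "grad f y \<bullet> w t = t * (grad f y \<bullet> d) + t\<^sup>2 * (grad f y \<bullet> e)"
        unfolding w_def by (simp add: inner_add_right)
      moreover have "f (y + t *\<^sub>R d + t\<^sup>2 *\<^sub>R e) = f (y + w t)" unfolding w_def by (simp add: add.assoc)
      ultimately show ?case using elim by (simp add: add_divide_distrib)
    qed
  qed
qed

section \<open>Necessary conditions\<close>

text \<open>The problem with the parameter \<open>x\<close> frozen: objective and constraints become
  functions of \<open>y\<close> alone, so a perturbed problem is just another instance.\<close>

definition local_min :: "('v::metric_space \<Rightarrow> real) \<Rightarrow> ('k \<Rightarrow> 'v \<Rightarrow> real) \<Rightarrow> 'v \<Rightarrow> bool" where
  "local_min f h y \<longleftrightarrow> (\<forall>i. h i y \<le> 0) \<and>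
     (\<exists>\<delta>>0. \<forall>z. (\<forall>i. h i z \<le> 0) \<longrightarrow> dist z y < \<delta> \<longrightarrow> f y \<le> f z)"

definition KKT :: "(real^'m \<Rightarrow> real) \<Rightarrow> ('k::finite \<Rightarrow> real^'m \<Rightarrow> real) \<Rightarrow> real^'m \<Rightarrow> ('k \<Rightarrow> real) \<Rightarrow> bool"
  where
  "KKT f h y l \<longleftrightarrow> grad f y + (\<Sum>i\<in>UNIV. l i *\<^sub>R grad (h i) y) = 0 \<and>
     (\<forall>i. h i y \<le> 0 \<and> 0 \<le> l i \<and> l i * h i y = 0)"

definition lagrangian_hess ::
  "(real^'m \<Rightarrow> real) \<Rightarrow> ('k::finite \<Rightarrow> real^'m \<Rightarrow> real) \<Rightarrow> ('k \<Rightarrow> real) \<Rightarrow> real^'m \<Rightarrow> real^'m^'m"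
  where
  "lagrangian_hess f h l y = hess f y + (\<Sum>i\<in>UNIV. l i *\<^sub>R hess (h i) y)"

lemma not_local_min_curve:
  fixes h :: "'k::finite \<Rightarrow> 'v::metric_space \<Rightarrow> real" and c :: "real \<Rightarrow> 'v"
  assumes "(c \<longlongrightarrow> y) (at_right 0)"
    and "\<And>i. eventually (\<lambda>t. h i (c t) < 0) (at_right 0)"
    and "eventually (\<lambda>t. f (c t) < f y) (at_right 0)"
  shows "\<not> local_min f h y"
proof
  assume "local_min f h y"
  then obtain \<delta> where \<delta>: "\<delta> > 0" "\<And>z. (\<forall>i. h i z \<le> 0) \<Longrightarrow> dist z y < \<delta> \<Longrightarrow> f y \<le> f z"
    unfolding local_min_def by blast
  have "eventually (\<lambda>t. \<forall>i. h i (c t) < 0) (at_right 0)"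
    using assms(2) by (rule eventually_all_finite)
  moreover have "eventually (\<lambda>t. dist (c t) y < \<delta>) (at_right 0)"
    using tendstoD[OF assms(1) \<delta>(1)] .
  ultimately have "eventually (\<lambda>t::real. False) (at_right 0)"
    using assms(3)
  proof eventually_elim
    case (elim t)
    then have "f y \<le> f (c t)" by (intro \<delta>(2)) (auto intro: less_imp_le)
    then show ?case using elim by simp
  qed
  then show False by simp
qed

lemma line_tendsto:
  assumes f: "C2_on f W" and y: "y \<in> W"
  shows "((\<lambda>t. f (y + t *\<^sub>R d + t\<^sup>2 *\<^sub>R e)) \<longlongrightarrow> f y) (at_right (0::real))"
proof -
  have "isCont f y"
    using C2_on_D(1,2)[OF f] y by (simp add: continuous_on_eq_continuous_at)
  moreover have "((\<lambda>t. y + t *\<^sub>R d + t\<^sup>2 *\<^sub>R e) \<longlongrightarrow> y + 0 *\<^sub>R d + 0\<^sup>2 *\<^sub>R e) (at_right (0::real))"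
    by (intro tendsto_intros)
  then have "((\<lambda>t. y + t *\<^sub>R d + t\<^sup>2 *\<^sub>R e) \<longlongrightarrow> y) (at_right (0::real))" by simp
  ultimately show ?thesis by (rule isCont_tendsto_compose)
qed

lemma decrease_right:
  assumes f: "C2_on f W" and y: "y \<in> W" and neg: "grad f y \<bullet> d < 0"
  shows "eventually (\<lambda>t. f (y + t *\<^sub>R d) < f y) (at_right 0)"
proof -
  have "\<exists>\<delta>>0. \<forall>t>0. t < \<delta> \<longrightarrow> f (y + (0 + t) *\<^sub>R d) < f (y + 0 *\<^sub>R d)"
    by (rule DERIV_neg_dec_right[OF line_derivative[OF f]]) (use y neg in auto)
  then show ?thesis by (auto simp: eventually_at_right_field)
qed

text \<open>A direction strictly decreasing all active constraints leads into the feasible set, so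
  it cannot decrease \<open>f\<close>. A limit extends this to weakly decreasing directions; applied
  to \<open>d\<close> and \<open>- d\<close> it makes the gradient of \<open>f\<close> vanish on the
  tangent space, and applied to \<open>- e i\<close> it gives the sign of the i-th
  multiplier.\<close>

lemma first_order_necessary:
  fixes h :: "'k::finite \<Rightarrow> real^'m \<Rightarrow> real"
  assumes f: "C2_on f W" and h: "\<And>i. C2_on (h i) W" and y: "y \<in> W" and lm: "local_min f h y"
    and e: "dual_family {i. h i y = 0} (\<lambda>i. grad (h i) y) e"
  obtains l where "KKT f h y l"
proof -
  define J where "J = {i. h i y = 0}"
  define a where "a i = grad (h i) y" for i
  have e: "dual_family J a e" using e unfolding J_def a_def .
  have feas: "h i y \<le> 0" for i using lm unfolding local_min_def by blast
  have dir: "0 \<le> grad f y \<bullet> d" if d: "\<And>i. i \<in> J \<Longrightarrow> a i \<bullet> d < 0" for d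
  proof (rule ccontr)
    assume "\<not> 0 \<le> grad f y \<bullet> d"
    then have *: "eventually (\<lambda>t. f (y + t *\<^sub>R d) < f y) (at_right 0)"
      by (intro decrease_right[OF f y]) simp
    have "eventually (\<lambda>t. h i (y + t *\<^sub>R d) < 0) (at_right 0)" for i
    proof (cases "i \<in> J")
      case True
      then show ?thesis using decrease_right[OF h y] d[OF True] unfolding a_def J_def by fastforce
    next
      case False
      then have "h i y < 0" using feas[of i] unfolding J_def by simp
      then show ?thesis using order_tendstoD(2)[OF line_tendsto[OF h y, where d=d and e=0]] by simp
    qed
    moreover have "((\<lambda>t. y + t *\<^sub>R d) \<longlongrightarrow> y + 0 *\<^sub>R d) (at_right 0)"
      by (intro tendsto_intros)
    then have "((\<lambda>t. y + t *\<^sub>R d) \<longlongrightarrow> y) (at_right 0)" by simp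
    ultimately have "\<not> local_min f h y"
      using not_local_min_curve[where c = "\<lambda>t. y + t *\<^sub>R d"] * by blast
    then show False using lm by simp
  qed
  have weak: "0 \<le> grad f y \<bullet> d" if d: "\<And>i. i \<in> J \<Longrightarrow> a i \<bullet> d \<le> 0" for d
  proof -
    \<comment> \<open>A direction with slope -1 along every active constraint. Adding a small
      multiple makes weak inequalities strict, and the multiple then tends to 0.\<close>
    define v where "v = (\<Sum>j\<in>J. (-1) *\<^sub>R e j)"
    have v: "a i \<bullet> v = -1" if "i \<in> J" for i
      unfolding v_def using dual_family_sum[OF _ e that, of "\<lambda>_. -1"] by simp
    have "((\<lambda>t. grad f y \<bullet> (d + t *\<^sub>R v)) \<longlongrightarrow> grad f y \<bullet> (d + 0 *\<^sub>R v)) (at_right 0)"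
      by (intro tendsto_intros)
    moreover have "eventually (\<lambda>t. 0 \<le> grad f y \<bullet> (d + t *\<^sub>R v)) (at_right 0)"
      using eventually_at_right_less
    proof eventually_elim
      case (elim t)
      show ?case
      proof (rule dir)
        fix i assume i: "i \<in> J"
        show "a i \<bullet> (d + t *\<^sub>R v) < 0" using d[OF i] v[OF i] elim by (simp add: inner_add_right)
      qed
    qed
    ultimately have "0 \<le> grad f y \<bullet> (d + 0 *\<^sub>R v)"
      by (rule tendsto_lowerbound) simp
    then show ?thesis by simp
  qed
  have fin: "finite J" by simp
  have "grad f y \<bullet> d = 0" if "\<And>i. i \<in> J \<Longrightarrow> a i \<bullet> d = 0" for d
    using weak[of d] weak[of "- d"] that by force
  then have comb: "grad f y = (\<Sum>j\<in>J. (grad f y \<bullet> e j) *\<^sub>R a j)"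
    by (rule dual_family_combination[OF fin e])
  define l where "l i = (if i \<in> J then - (grad f y \<bullet> e i) else 0)" for i
  have "(\<Sum>i\<in>UNIV. l i *\<^sub>R grad (h i) y) = (\<Sum>i\<in>J. (- (grad f y \<bullet> e i)) *\<^sub>R a i)"
    unfolding l_def a_def by (intro sum.mono_neutral_cong_right) auto
  also have "\<dots> = - (\<Sum>j\<in>J. (grad f y \<bullet> e j) *\<^sub>R a j)" by (simp add: sum_negf)
  finally have "grad f y + (\<Sum>i\<in>UNIV. l i *\<^sub>R grad (h i) y) = 0"
    unfolding comb[symmetric] by simp
  moreover have "0 \<le> l i" for i
  proof (cases "i \<in> J")
    case True
    have "0 \<le> grad f y \<bullet> (- e i)"
    proof (rule weak)
      fix j assume "j \<in> J"
      then have "a j \<bullet> e i = (if j = i then 1 else 0)" using e True unfolding dual_family_def by simp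
      then show "a j \<bullet> - e i \<le> 0" by simp
    qed
    then show ?thesis using True by (simp add: l_def)
  qed (simp add: l_def)
  moreover have "l i * h i y = 0" for i unfolding l_def J_def by auto
  ultimately show ?thesis using feas that[of l] unfolding KKT_def by blast
qed

text \<open>The parabola \<open>y + t d + t\<^sup>2 e\<close> replaces a curve in the constraint manifold: since the
  constraints are inequalities, its curvature \<open>e\<close> can be chosen to push it strictly inside.\<close>

lemma second_order_necessary:
  fixes h :: "'k::finite \<Rightarrow> real^'m \<Rightarrow> real"
  assumes f: "C2_on f W" and h: "\<And>i. C2_on (h i) W" and y: "y \<in> W" and lm: "local_min f h y"
    and e: "dual_family {i. h i y = 0} (\<lambda>i. grad (h i) y) e"
    and kkt: "KKT f h y l"
    and d: "\<And>i. h i y = 0 \<Longrightarrow> grad (h i) y \<bullet> d = 0"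
  shows "0 \<le> d \<bullet> (lagrangian_hess f h l y *v d)"
proof (rule ccontr)
  define J where "J = {i. h i y = 0}"
  define a where "a i = grad (h i) y" for i
  define q where "q i = d \<bullet> (hess (h i) y *v d)" for i
  have e: "dual_family J a e" using e unfolding J_def a_def .
  have l0: "l i = 0" if "i \<notin> J" for i using kkt that unfolding KKT_def J_def by auto
  have lJ: "(\<Sum>i\<in>UNIV. l i * x i) = (\<Sum>i\<in>J. l i * x i)" for x
    using l0 by (intro sum.mono_neutral_right) auto
  have grad: "grad f y = - (\<Sum>i\<in>UNIV. l i *\<^sub>R a i)"
    using kkt unfolding KKT_def a_def by (simp add: eq_neg_iff_add_eq_0)
  let ?Q = "d \<bullet> (lagrangian_hess f h l y *v d)"
  have Q: "?Q = d \<bullet> (hess f y *v d) + (\<Sum>i\<in>J. l i * q i)"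
    unfolding lagrangian_hess_def matrix_vector_mult_add_rdistrib sum_matrix_vector_mult
    by (simp add: inner_add_right inner_sum_right q_def lJ)
  assume "\<not> 0 \<le> ?Q"
  then have neg: "?Q < 0" by simp
  define S where "S = (\<Sum>i\<in>J. l i)"
  have S: "S \<ge> 0" unfolding S_def using kkt by (auto simp: KKT_def intro: sum_nonneg)
  \<comment> \<open>Any slack whose total cost \<open>\<delta> * S\<close> is below
    \<open>- ?Q / 2\<close> would do; this one costs at most \<open>- ?Q / 4\<close>. The 1 covers
    the case that all multipliers vanish.\<close>
  define \<delta> where "\<delta> = - ?Q / (4 * (1 + S))"
  have \<delta>: "\<delta> > 0" unfolding \<delta>_def using neg S by (intro divide_pos_pos) auto
  have "\<delta> * S \<le> \<delta> * (1 + S)" using \<delta> by simp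
  also have "\<dots> = - ?Q / 4" unfolding \<delta>_def using S by (simp add: field_simps)
  finally have \<delta>S: "?Q / 2 + \<delta> * S < 0" using neg by simp
  \<comment> \<open>With slope \<open>u i\<close> along \<open>w\<close>, the t^2 coefficient of the
    i-th active constraint is exactly \<open>- \<delta>\<close>. By stationarity the coefficient of
    \<open>f\<close> then becomes \<open>?Q / 2 + \<delta> * S\<close>.\<close>
  define u where "u i = - q i / 2 - \<delta>" for i
  define w where "w = (\<Sum>j\<in>J. u j *\<^sub>R e j)"
  have aw: "a i \<bullet> w = u i" if "i \<in> J" for i
    unfolding w_def by (rule dual_family_sum[OF _ e that]) simp
  define c where "c t = y + t *\<^sub>R d + t\<^sup>2 *\<^sub>R w" for t
  have c: "(c \<longlongrightarrow> y) (at_right 0)"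
  proof -
    have "(c \<longlongrightarrow> y + 0 *\<^sub>R d + 0\<^sup>2 *\<^sub>R w) (at_right 0)" unfolding c_def by (intro tendsto_intros)
    then show ?thesis by simp
  qed
  have drop: "eventually (\<lambda>t. k (c t) < k y) (at_right 0)"
    if k: "C2_on k W" "grad k y \<bullet> d = 0" "grad k y \<bullet> w + d \<bullet> (hess k y *v d) / 2 < 0" for k
    using order_tendstoD(2)[OF taylor_parabola[OF k(1) y, of d w] k(3)] eventually_at_right_less
  proof eventually_elim
    case (elim t)
    then show ?case unfolding c_def k(2) by (simp add: divide_less_0_iff)
  qed
  have "eventually (\<lambda>t. f (c t) < f y) (at_right 0)"
  proof (rule drop[OF f])
    have "(\<Sum>i\<in>UNIV. l i * (a i \<bullet> d)) = 0" using d l0 unfolding a_def J_def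
      by (intro sum.neutral) auto
    then show "grad f y \<bullet> d = 0" unfolding grad by (simp add: inner_sum_left)
    have "grad f y \<bullet> w = - (\<Sum>i\<in>J. l i * u i)"
      unfolding grad by (simp add: inner_sum_left lJ aw)
    also have "\<dots> = (\<Sum>i\<in>J. l i * q i) / 2 + \<delta> * S"
      unfolding u_def S_def sum_distrib_left sum_divide_distrib sum_negf[symmetric] sum.distrib[symmetric]
      by (intro sum.cong) (auto simp: algebra_simps)
    finally show "grad f y \<bullet> w + d \<bullet> (hess f y *v d) / 2 < 0"
      using \<delta>S unfolding Q by argo
  qed
  moreover have "eventually (\<lambda>t. h i (c t) < 0) (at_right 0)" for i
  proof (cases "i \<in> J")
    case True
    have "eventually (\<lambda>t. h i (c t) < h i y) (at_right 0)"
    proof (rule drop[OF h])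
      show "grad (h i) y \<bullet> d = 0" using d True unfolding J_def by simp
      show "grad (h i) y \<bullet> w + d \<bullet> (hess (h i) y *v d) / 2 < 0"
        using aw[OF True] \<delta> unfolding a_def u_def q_def by simp
    qed
    then show ?thesis using True unfolding J_def by simp
  next
    case False
    then have "h i y < 0" using kkt unfolding J_def KKT_def by (auto simp: less_le)
    then show ?thesis using order_tendstoD(2)[OF line_tendsto[OF h y]] unfolding c_def by blast
  qed
  ultimately have "\<not> local_min f h y"
    using not_local_min_curve[OF c] by blast
  then show False using lm by simp
qed

text \<open>Such a \<open>v\<close> minimizes the quadratic form on the tangent space, so the first
  variation in every tangent direction vanishes. Hence \<open>M *v v\<close> is orthogonal to the
  tangent space, that is, a combination of the \<open>a j\<close>.\<close>

lemma semidefinite_null: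
  fixes M :: "real^'m^'m" and a :: "'k::finite \<Rightarrow> real^'m"
  assumes sym: "\<And>u v. u \<bullet> (M *v v) = v \<bullet> (M *v u)" and e: "dual_family J a e"
    and psd: "\<And>v. (\<And>i. i \<in> J \<Longrightarrow> a i \<bullet> v = 0) \<Longrightarrow> 0 \<le> v \<bullet> (M *v v)"
    and v: "\<And>i. i \<in> J \<Longrightarrow> a i \<bullet> v = 0" "v \<bullet> (M *v v) \<le> 0"
  obtains \<mu> where "M *v v = (\<Sum>j\<in>J. \<mu> j *\<^sub>R a j)"
proof -
  have "(M *v v) \<bullet> u = 0" if u: "\<And>i. i \<in> J \<Longrightarrow> a i \<bullet> u = 0" for u
  proof (rule ccontr)
    define p where "p = u \<bullet> (M *v v)"
    define q where "q = u \<bullet> (M *v u)"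
    assume "(M *v v) \<bullet> u \<noteq> 0"
    then have p: "p \<noteq> 0" unfolding p_def by (simp add: inner_commute)
    have q: "q \<ge> 0" unfolding q_def using psd[of u] u by blast
    have poly: "0 \<le> 2 * t * p + t * t * q" for t
    proof -
      have "0 \<le> (v + t *\<^sub>R u) \<bullet> (M *v (v + t *\<^sub>R u))"
        using u v(1) by (intro psd) (simp add: inner_add_right)
      also have "\<dots> = v \<bullet> (M *v v) + 2 * t * p + t * t * q"
        using sym[of v u] by (simp add: p_def q_def matrix_vector_right_distrib matrix_vector_mult_scaleR
            inner_add_left inner_add_right algebra_simps)
      finally show ?thesis using v(2) by linarith
    qed
    \<comment> \<open>The exact minimizer of the quadratic would be \<open>- p / q\<close>; the
      denominator \<open>1 + q\<close> also covers \<open>q = 0\<close> and still makes the value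
      negative.\<close>
    define s where "s = 1 / (1 + q)"
    have s: "s > 0" "s * q < 1" unfolding s_def using q by auto
    have "0 \<le> p * p * s * (s * q - 2)" using poly[of "- p * s"] by (simp add: algebra_simps)
    moreover have "p * p * s > 0" using p s(1) by (metis mult_pos_pos not_real_square_gt_zero)
    ultimately show False using s(2) by (simp add: zero_le_mult_iff)
  qed
  then show ?thesis
    using dual_family_combination[OF finite e, of "M *v v"] that[of "\<lambda>j. (M *v v) \<bullet> e j"] by blast
qed

section \<open>Perturbations converging in \<open>C\<^sup>2\<close>\<close>

text \<open>Uniformity on the open set \<open>W\<close>, together with continuity of the limits,
  allows evaluation at points that move with n.\<close>

definition C2_converges :: "(nat \<Rightarrow> real^'m \<Rightarrow> real) \<Rightarrow> (real^'m \<Rightarrow> real) \<Rightarrow> (real^'m) set \<Rightarrow> bool" where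
  "C2_converges F f W \<longleftrightarrow> C2_on f W \<and> (\<forall>n. C2_on (F n) W) \<and>
     uniform_limit W F f sequentially \<and>
     uniform_limit W (\<lambda>n. grad (F n)) (grad f) sequentially \<and>
     uniform_limit W (\<lambda>n. hess (F n)) (hess f) sequentially"

lemma uniform_limit_tendsto:
  fixes f :: "'a::t2_space \<Rightarrow> 'b::metric_space"
  assumes "uniform_limit W F f sequentially" "continuous_on W f" "open W" "y \<in> W" "z \<longlonglongrightarrow> y"
  shows "(\<lambda>n. F n (z n)) \<longlonglongrightarrow> f y"
proof -
  have ev: "eventually (\<lambda>n. z n \<in> W) sequentially"
    using assms(3-5) by (simp add: topological_tendstoD)
  have "isCont f y" using assms(2-4) by (simp add: continuous_on_eq_continuous_at)
  then have lim: "(\<lambda>n. f (z n)) \<longlonglongrightarrow> f y"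
    using assms(5) by (rule isCont_tendsto_compose)
  show ?thesis
  proof (rule tendstoI)
    fix e :: real assume "e > 0"
    then have "e / 2 > 0" by simp
    show "eventually (\<lambda>n. dist (F n (z n)) (f y) < e) sequentially"
      using uniform_limitD[OF assms(1) \<open>e / 2 > 0\<close>] tendstoD[OF lim \<open>e / 2 > 0\<close>] ev
    proof eventually_elim
      case (elim n)
      show ?case
        by (rule dist_triangle_half_l[where y = "f (z n)"]) (use elim in \<open>auto simp: dist_commute\<close>)
    qed
  qed
qed

lemma C2_convergesD:
  assumes "C2_converges F f W"
  shows "C2_on f W" "\<And>n. C2_on (F n) W" "open W"
    and "y \<in> W \<Longrightarrow> z \<longlonglongrightarrow> y \<Longrightarrow> (\<lambda>n. F n (z n)) \<longlonglongrightarrow> f y"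
    and "y \<in> W \<Longrightarrow> z \<longlonglongrightarrow> y \<Longrightarrow> (\<lambda>n. grad (F n) (z n)) \<longlonglongrightarrow> grad f y"
    and "y \<in> W \<Longrightarrow> z \<longlonglongrightarrow> y \<Longrightarrow> (\<lambda>n. hess (F n) (z n)) \<longlonglongrightarrow> hess f y"
proof -
  show *: "C2_on f W" "\<And>n. C2_on (F n) W" "open W"
    using assms by (auto simp: C2_converges_def C2_on_def)
  note lim = uniform_limit_tendsto[OF _ _ *(3)]
  note cont = C2_on_D(2-4)[OF *(1)]
  have u: "uniform_limit W F f sequentially" "uniform_limit W (\<lambda>n. grad (F n)) (grad f) sequentially"
    "uniform_limit W (\<lambda>n. hess (F n)) (hess f) sequentially"
    using assms unfolding C2_converges_def by auto
  show "y \<in> W \<Longrightarrow> z \<longlonglongrightarrow> y \<Longrightarrow> (\<lambda>n. F n (z n)) \<longlonglongrightarrow> f y"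
    using lim[OF u(1) cont(1)] .
  show "y \<in> W \<Longrightarrow> z \<longlonglongrightarrow> y \<Longrightarrow> (\<lambda>n. grad (F n) (z n)) \<longlonglongrightarrow> grad f y"
    using lim[OF u(2) cont(2)] .
  show "y \<in> W \<Longrightarrow> z \<longlonglongrightarrow> y \<Longrightarrow> (\<lambda>n. hess (F n) (z n)) \<longlonglongrightarrow> hess f y"
    using lim[OF u(3) cont(3)] .
qed

lemma uniform_limit_subseq:
  assumes "uniform_limit W G k sequentially" "strict_mono \<sigma>"
  shows "uniform_limit W (\<lambda>n. G (\<sigma> n)) k sequentially"
  using filterlim_compose[OF assms(1) filterlim_subseq[OF assms(2)]] .

lemma C2_converges_subseq:
  assumes "C2_converges F f W" "strict_mono \<sigma>"
  shows "C2_converges (\<lambda>n. F (\<sigma> n)) f W"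
  using assms
  unfolding C2_converges_def
  by (auto intro: uniform_limit_subseq[where G = F] uniform_limit_subseq[where G = "\<lambda>n. grad (F n)"]
      uniform_limit_subseq[where G = "\<lambda>n. hess (F n)"])

text \<open>Specializes the results on perturbed sequences to the unperturbed problem.\<close>

lemma C2_converges_const: "C2_on f W \<Longrightarrow> C2_converges (\<lambda>n. f) f W"
  unfolding C2_converges_def by (simp add: uniform_limit_iff)

text \<open>The segments from \<open>p n\<close> to \<open>z n\<close> eventually lie in a ball
  inside \<open>W\<close>, hence the eventual conclusion; the intermediate points are squeezed
  towards \<open>y\<close>.\<close>

lemma taylor_sequence:
  assumes F: "\<And>n. C2_on (F n) W" and W: "open W" "y \<in> W" and lim: "p \<longlonglongrightarrow> y" "z \<longlonglongrightarrow> y"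
  obtains \<xi> where "\<xi> \<longlonglongrightarrow> y"
    "eventually (\<lambda>n. F n (z n) = F n (p n) + grad (F n) (p n) \<bullet> (z n - p n)
       + (z n - p n) \<bullet> (hess (F n) (\<xi> n) *v (z n - p n)) / 2) sequentially"
proof -
  obtain r where r: "r > 0" "ball y r \<subseteq> W" using W openE by blast
  have "eventually (\<lambda>n. \<exists>\<xi>. dist \<xi> (p n) \<le> dist (z n) (p n) \<and>
    F n (z n) = F n (p n) + grad (F n) (p n) \<bullet> (z n - p n)
       + (z n - p n) \<bullet> (hess (F n) \<xi> *v (z n - p n)) / 2) sequentially"
    using tendstoD[OF lim(1) r(1)] tendstoD[OF lim(2) r(1)]
  proof eventually_elim
    case (elim n)
    have "closed_segment (p n) (z n) \<subseteq> ball y r"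
      using elim by (intro closed_segment_subset) (auto simp: dist_commute)
    then have "closed_segment (p n) (z n) \<subseteq> W" using r(2) by blast
    from taylor_second_order[OF F this] obtain \<xi> where \<xi>: "\<xi> \<in> closed_segment (p n) (z n)"
      "F n (z n) = F n (p n) + grad (F n) (p n) \<bullet> (z n - p n)
       + (z n - p n) \<bullet> (hess (F n) \<xi> *v (z n - p n)) / 2" by blast
    then show ?case using segment_bound(1)[OF \<xi>(1)] by (auto simp: dist_norm norm_minus_commute)
  qed
  then obtain \<xi> where ev: "eventually (\<lambda>n. dist (\<xi> n) (p n) \<le> dist (z n) (p n) \<and>
    F n (z n) = F n (p n) + grad (F n) (p n) \<bullet> (z n - p n)
       + (z n - p n) \<bullet> (hess (F n) (\<xi> n) *v (z n - p n)) / 2) sequentially"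
    by (rule eventually_choice)
  have "(\<lambda>n. dist (z n) (p n)) \<longlonglongrightarrow> dist y y" by (intro tendsto_intros lim)
  then have "(\<lambda>n. dist (z n) (p n)) \<longlonglongrightarrow> 0" by simp
  then have "(\<lambda>n. \<xi> n - p n) \<longlonglongrightarrow> 0"
    by (rule Lim_null_comparison[OF eventually_mono[OF ev], rotated]) (simp add: dist_norm)
  from tendsto_add[OF this lim(1)] have "\<xi> \<longlonglongrightarrow> y" by simp
  then show ?thesis by (rule that) (rule eventually_mono[OF ev], simp)
qed

text \<open>A directional derivative with function, base point and direction all varying. Expanding
  around \<open>p n\<close>, the Hessian term carries a spare factor \<open>norm (z n - p n)\<close>
  and disappears.\<close>

lemma difference_quotient_sequence:
  assumes F: "C2_converges F f W" and y: "y \<in> W" and lim: "p \<longlonglongrightarrow> y" "z \<longlonglongrightarrow> y"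
    and ne: "\<And>n. z n \<noteq> p n" and w: "(\<lambda>n. sgn (z n - p n)) \<longlonglongrightarrow> w"
  shows "(\<lambda>n. (F n (z n) - F n (p n)) / norm (z n - p n)) \<longlonglongrightarrow> grad f y \<bullet> w"
proof -
  note C2_convergesD[OF F]
  note F = this
  obtain \<xi> where \<xi>: "\<xi> \<longlonglongrightarrow> y"
    "eventually (\<lambda>n. F n (z n) = F n (p n) + grad (F n) (p n) \<bullet> (z n - p n)
       + (z n - p n) \<bullet> (hess (F n) (\<xi> n) *v (z n - p n)) / 2) sequentially"
    by (rule taylor_sequence[where F = F, OF F(2,3) y lim])
  let ?w = "\<lambda>n. sgn (z n - p n)"
  have "(\<lambda>n. norm (z n - p n)) \<longlonglongrightarrow> norm (y - y)" by (intro tendsto_intros lim)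
  then have D: "(\<lambda>n. norm (z n - p n)) \<longlonglongrightarrow> 0" by simp
  have quad: "(\<lambda>n. ?w n \<bullet> (hess (F n) (\<xi> n) *v ?w n)) \<longlonglongrightarrow> w \<bullet> (hess f y *v w)"
    by (rule tendsto_inner[OF w tendsto_matrix_vector_mult[OF F(6)[OF y \<xi>(1)] w]])
  have "(\<lambda>n. grad (F n) (p n) \<bullet> ?w n + norm (z n - p n) * (?w n \<bullet> (hess (F n) (\<xi> n) *v ?w n)) / 2)
      \<longlonglongrightarrow> grad f y \<bullet> w + 0 * (w \<bullet> (hess f y *v w)) / 2"
    by (rule tendsto_add[OF tendsto_inner[OF F(5)[OF y lim(1)] w]
          tendsto_divide[OF tendsto_mult[OF D quad] tendsto_const]]) simp
  then have "(\<lambda>n. grad (F n) (p n) \<bullet> ?w n + norm (z n - p n) * (?w n \<bullet> (hess (F n) (\<xi> n) *v ?w n)) / 2)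
      \<longlonglongrightarrow> grad f y \<bullet> w" by simp
  then show ?thesis
  proof (rule Lim_transform_eventually)
    show "eventually (\<lambda>n. grad (F n) (p n) \<bullet> ?w n + norm (z n - p n) * (?w n \<bullet> (hess (F n) (\<xi> n) *v ?w n)) / 2
       = (F n (z n) - F n (p n)) / norm (z n - p n)) sequentially"
      using \<xi>(2)
    proof eventually_elim
      case (elim n)
      have pos: "norm (z n - p n) > 0" using ne[of n] by simp
      define t where "t = norm (z n - p n)"
      define v where "v = ?w n"
      have zp: "z n - p n = t *\<^sub>R v" unfolding t_def v_def using pos by (simp add: sgn_div_norm)
      have "F n (z n) - F n (p n) = t * (grad (F n) (p n) \<bullet> v + t * (v \<bullet> (hess (F n) (\<xi> n) *v v)) / 2)"
        using elim unfolding zp by (simp add: matrix_vector_mult_scaleR distrib_left)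
      then show ?case using pos unfolding v_def t_def by simp
    qed
  qed
qed

lemma lagrangian_hess_tendsto:
  fixes h :: "'k::finite \<Rightarrow> real^'m \<Rightarrow> real"
  assumes F: "C2_converges F f W" and H: "\<And>i. C2_converges (\<lambda>n. H n i) (h i) W"
    and "y \<in> W" "p \<longlonglongrightarrow> y" and l: "\<And>i. (\<lambda>n. ls n i) \<longlonglongrightarrow> l i"
  shows "(\<lambda>n. lagrangian_hess (F n) (H n) (ls n) (p n)) \<longlonglongrightarrow> lagrangian_hess f h l y"
  unfolding lagrangian_hess_def
  by (rule tendsto_add[OF C2_convergesD(6)[OF F assms(3,4)]
        tendsto_sum[OF tendsto_scaleR[OF l C2_convergesD(6)[OF H assms(3,4)]]]])

text \<open>The second-order sufficient condition. Under strict complementarity the tangent space is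
  the whole critical cone, so no inequality directions need to be tested.\<close>

definition definite_on_tangent ::
  "(real^'m \<Rightarrow> real) \<Rightarrow> ('k::finite \<Rightarrow> real^'m \<Rightarrow> real) \<Rightarrow> real^'m \<Rightarrow> ('k \<Rightarrow> real) \<Rightarrow> bool" where
  "definite_on_tangent f h y l \<longleftrightarrow>
     (\<forall>v. v \<noteq> 0 \<longrightarrow> (\<forall>i. h i y = 0 \<longrightarrow> grad (h i) y \<bullet> v = 0) \<longrightarrow> 0 < v \<bullet> (lagrangian_hess f h l y *v v))"

section \<open>Uniform growth of the objective near KKT points\<close>

lemma compact_subsequence:
  fixes q :: "nat \<Rightarrow> 'v::metric_space"
  assumes "compact K" "\<And>n. q n \<in> K"
  obtains l \<tau> where "strict_mono \<tau>" "(\<lambda>n. q (\<tau> n)) \<longlonglongrightarrow> l" "l \<in> K"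
proof -
  have "\<exists>l\<in>K. \<exists>\<tau>. strict_mono \<tau> \<and> (q \<circ> \<tau>) \<longlonglongrightarrow> l"
    using compact_imp_seq_compact[OF assms(1)] assms(2) unfolding seq_compact_def by auto
  then show thesis using that unfolding comp_def by blast
qed

text \<open>Strict complementarity forces the limit direction \<open>w\<close> to be tangent to the active constraints, so
  that the second-order term of the Lagrangian decides.\<close>

lemma growth_direction:
  fixes h :: "'k::finite \<Rightarrow> real^'m \<Rightarrow> real"
  assumes F: "C2_converges F f W" and H: "\<And>i. C2_converges (\<lambda>n. H n i) (h i) W"
    and y: "y \<in> W" and lim: "p \<longlonglongrightarrow> y" "z \<longlonglongrightarrow> y"
    and l: "\<And>i. (\<lambda>n. ls n i) \<longlonglongrightarrow> l i"
    and kkt: "KKT f h y l" and kkt_n: "eventually (\<lambda>n. KKT (F n) (H n) (p n) (ls n)) sequentially"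
    and sc: "\<And>i. h i y = 0 \<Longrightarrow> 0 < l i" and pd: "definite_on_tangent f h y l"
    and feas: "\<And>n i. H n i (z n) \<le> 0" and ne: "\<And>n. z n \<noteq> p n"
    and w: "(\<lambda>n. sgn (z n - p n)) \<longlonglongrightarrow> w"
    and le: "\<And>n. F n (z n) \<le> F n (p n)"
  shows False
proof -
  note Hc = C2_convergesD[OF H] and Fc = C2_convergesD[OF F]
  let ?d = "\<lambda>n. norm (z n - p n)"
  have pos: "?d n > 0" for n using ne[of n] by simp
  have "norm (sgn (z n - p n)) = 1" for n using ne[of n] by (simp add: norm_sgn)
  then have "norm w = 1" using tendsto_norm[OF w] by (simp add: LIMSEQ_const_iff)
  then have w0: "w \<noteq> 0" by auto
  have tangent_le: "grad (h i) y \<bullet> w \<le> 0" if "h i y = 0" for i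
  proof -
    have "eventually (\<lambda>n. 0 < ls n i) sequentially"
      using order_tendstoD(1)[OF l sc[OF that]] .
    \<comment> \<open>A positive multiplier forces \<open>H n i (p n) = 0\<close>, while
      \<open>z n\<close> is feasible; so the constraint does not increase from \<open>p n\<close> to
      \<open>z n\<close>.\<close>
    then have "eventually (\<lambda>n. (H n i (z n) - H n i (p n)) / ?d n \<le> 0) sequentially"
      using kkt_n
    proof eventually_elim
      case (elim n)
      then have "H n i (p n) = 0" unfolding KKT_def by (metis mult_eq_0_iff less_irrefl)
      then show ?case using feas[of n i] pos[of n] by (simp add: divide_nonpos_pos)
    qed
    then show ?thesis
      by (rule tendsto_upperbound[OF difference_quotient_sequence[OF H y lim ne w]]) simp
  qed
  have "grad f y \<bullet> w \<le> 0"
  proof (rule tendsto_upperbound[OF difference_quotient_sequence[OF F y lim ne w]])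
    show "eventually (\<lambda>n. (F n (z n) - F n (p n)) / ?d n \<le> 0) sequentially"
      using le pos by (auto intro!: always_eventually divide_nonpos_pos)
  qed simp
  moreover have "grad f y \<bullet> w + (\<Sum>i\<in>UNIV. l i * (grad (h i) y \<bullet> w)) = 0"
  proof -
    have "(grad f y + (\<Sum>i\<in>UNIV. l i *\<^sub>R grad (h i) y)) \<bullet> w = 0"
      using kkt unfolding KKT_def by simp
    then show ?thesis by (simp add: inner_add_left inner_sum_left)
  qed
  \<comment> \<open>Stationarity at \<open>y\<close> writes the slope of \<open>f\<close> as a sum
    of nonnegative terms, and that slope is at most 0; so each term vanishes, and a positive
    multiplier passes this on to the slope of its constraint.\<close>
  ultimately have "(\<Sum>i\<in>UNIV. - (l i * (grad (h i) y \<bullet> w))) \<le> 0" by (simp add: sum_negf)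
  moreover have nn: "0 \<le> - (l i * (grad (h i) y \<bullet> w))" for i
  proof (cases "h i y = 0")
    case True
    then show ?thesis using tangent_le[OF True] sc[OF True] by (simp add: mult_le_0_iff)
  next
    case False
    then have "l i = 0" using kkt unfolding KKT_def by auto
    then show ?thesis by simp
  qed
  ultimately have "(\<Sum>i\<in>UNIV. - (l i * (grad (h i) y \<bullet> w))) = 0"
    by (intro antisym sum_nonneg) auto
  then have "l i * (grad (h i) y \<bullet> w) = 0" for i
    using nn by (subst (asm) sum_nonneg_eq_0_iff) auto
  then have tangent: "grad (h i) y \<bullet> w = 0" if "h i y = 0" for i
    using sc[OF that] by (metis mult_eq_0_iff less_irrefl)
  \<comment> \<open>The Lagrangian with the multiplier frozen at \<open>ls n\<close>: its gradient
    vanishes at \<open>p n\<close>, it equals \<open>F n\<close> there, and it is at most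
    \<open>F n\<close> at the feasible \<open>z n\<close>. Its Taylor expansion therefore leaves
    only a Hessian term, which must be nonpositive.\<close>
  define L where "L n v = F n v + (\<Sum>i\<in>UNIV. ls n i * H n i v)" for n v
  have LC: "C2_on (L n) W" for n
    unfolding L_def by (rule C2_on_lagrangian(1)[where h = "H n", OF Fc(2) Hc(2)])
  have Lg: "grad (L n) v = grad (F n) v + (\<Sum>i\<in>UNIV. ls n i *\<^sub>R grad (H n i) v)"
    and Lh: "hess (L n) v = lagrangian_hess (F n) (H n) (ls n) v" if "v \<in> W" for n v
    unfolding L_def lagrangian_hess_def
    using C2_on_lagrangian(2,3)[where h = "H n", OF Fc(2) Hc(2) that] by auto
  obtain \<xi> where \<xi>: "\<xi> \<longlonglongrightarrow> y"
    "eventually (\<lambda>n. L n (z n) = L n (p n) + grad (L n) (p n) \<bullet> (z n - p n)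
       + (z n - p n) \<bullet> (hess (L n) (\<xi> n) *v (z n - p n)) / 2) sequentially"
    by (rule taylor_sequence[where F = L, OF LC Fc(3) y lim])
  let ?w = "\<lambda>n. sgn (z n - p n)" and ?M = "\<lambda>n. lagrangian_hess (F n) (H n) (ls n) (\<xi> n)"
  have inW: "eventually (\<lambda>n. q n \<in> W) sequentially" if "q \<longlonglongrightarrow> y" for q
    using that Fc(3) y by (simp add: topological_tendstoD)
  have "eventually (\<lambda>n. ?w n \<bullet> (?M n *v ?w n) \<le> 0) sequentially"
    using \<xi>(2) inW[OF \<xi>(1)] inW[OF lim(1)] kkt_n
  proof eventually_elim
    case (elim n)
    have "grad (L n) (p n) = 0" using elim(4) unfolding Lg[OF elim(3)] KKT_def by simp
    moreover have "(\<Sum>i\<in>UNIV. ls n i * H n i (p n)) = 0"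
      using elim(4) unfolding KKT_def by (intro sum.neutral) blast
    then have "L n (p n) = F n (p n)" unfolding L_def by simp
    moreover have "L n (z n) \<le> F n (z n)"
      using elim(4) feas[of n] unfolding L_def KKT_def by (simp add: sum_nonpos mult_nonneg_nonpos)
    ultimately have "(z n - p n) \<bullet> (?M n *v (z n - p n)) \<le> 0"
      using elim(1) le[of n] unfolding Lh[OF elim(2)] by simp
    moreover obtain t v where tv: "t = ?d n" "v = ?w n" by blast
    then have "z n - p n = t *\<^sub>R v" using ne[of n] by (simp add: sgn_div_norm)
    ultimately have "t * (t * (v \<bullet> (?M n *v v))) \<le> 0"
      by (simp add: matrix_vector_mult_scaleR)
    moreover have "t > 0" using tv(1) pos[of n] by simp
    ultimately show ?case unfolding tv(2)[symmetric] by (simp add: mult_le_0_iff)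
  qed
  moreover have "(\<lambda>n. ?w n \<bullet> (?M n *v ?w n)) \<longlonglongrightarrow> w \<bullet> (lagrangian_hess f h l y *v w)"
    by (rule tendsto_inner[OF w tendsto_matrix_vector_mult[OF lagrangian_hess_tendsto[OF F H y \<xi>(1) l] w]])
  ultimately have "w \<bullet> (lagrangian_hess f h l y *v w) \<le> 0"
    by (intro tendsto_upperbound[where F = sequentially]) auto
  then show False using pd w0 tangent unfolding definite_on_tangent_def by force
qed

text \<open>If growth failed infinitely often, the normalized differences would have a limit on the
  unit sphere along a subsequence, which \<open>growth_direction\<close> excludes. The points
  \<open>p n\<close> are assumed to be KKT points only, so growth also serves to prove
  minimality.\<close>

lemma eventually_growth:
  fixes h :: "'k::finite \<Rightarrow> real^'m \<Rightarrow> real"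
  assumes F: "C2_converges F f W" and H: "\<And>i. C2_converges (\<lambda>n. H n i) (h i) W"
    and y: "y \<in> W" and lim: "p \<longlonglongrightarrow> y" "z \<longlonglongrightarrow> y"
    and l: "\<And>i. (\<lambda>n. ls n i) \<longlonglongrightarrow> l i"
    and kkt: "KKT f h y l" and kkt_n: "eventually (\<lambda>n. KKT (F n) (H n) (p n) (ls n)) sequentially"
    and sc: "\<And>i. h i y = 0 \<Longrightarrow> 0 < l i" and pd: "definite_on_tangent f h y l"
    and feas: "\<And>n i. H n i (z n) \<le> 0"
  shows "eventually (\<lambda>n. z n = p n \<or> F n (p n) < F n (z n)) sequentially"
proof (rule ccontr)
  assume "\<not> ?thesis"
  then have "\<exists>\<sigma>::nat \<Rightarrow> nat. strict_mono \<sigma> \<and> (\<forall>n. \<not> (z (\<sigma> n) = p (\<sigma> n) \<or> F (\<sigma> n) (p (\<sigma> n)) < F (\<sigma> n) (z (\<sigma> n))))"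
    by (rule not_eventually_sequentiallyD)
  then obtain \<sigma> :: "nat \<Rightarrow> nat" where \<sigma>: "strict_mono \<sigma>" "(\<forall>n. \<not> (z (\<sigma> n) = p (\<sigma> n) \<or> F (\<sigma> n) (p (\<sigma> n)) < F (\<sigma> n) (z (\<sigma> n))))"
    by blast
  then have \<sigma>_le: "F (\<sigma> n) (z (\<sigma> n)) \<le> F (\<sigma> n) (p (\<sigma> n))" for n by (auto simp: not_less)
  have "sgn (z (\<sigma> n) - p (\<sigma> n)) \<in> sphere 0 1" for n using \<sigma>(2) by (simp add: norm_sgn)
  then obtain w \<tau> where \<tau>: "strict_mono \<tau>" "(\<lambda>n. sgn (z (\<sigma> (\<tau> n)) - p (\<sigma> (\<tau> n)))) \<longlonglongrightarrow> w"
    by (rule compact_subsequence[OF compact_sphere, where q = "\<lambda>n. sgn (z (\<sigma> n) - p (\<sigma> n))"])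
  have sm: "strict_mono (\<sigma> \<circ> \<tau>)" using \<sigma>(1) \<tau>(1) by (rule strict_mono_o)
  define \<rho> where "\<rho> = \<sigma> \<circ> \<tau>"
  have sm: "strict_mono \<rho>" using sm unfolding \<rho>_def .
  note sub = LIMSEQ_subseq_LIMSEQ[OF _ sm, unfolded comp_def]
  show False
  proof (rule growth_direction[where F = "\<lambda>n. F (\<rho> n)" and H = "\<lambda>n. H (\<rho> n)" and p = "\<lambda>n. p (\<rho> n)"
        and z = "\<lambda>n. z (\<rho> n)" and ls = "\<lambda>n. ls (\<rho> n)", OF C2_converges_subseq[OF F sm] C2_converges_subseq[OF H sm] y
        sub[OF lim(1)] sub[OF lim(2)] sub[OF l] kkt _ sc pd])
    show "eventually (\<lambda>n. KKT (F (\<rho> n)) (H (\<rho> n)) (p (\<rho> n)) (ls (\<rho> n))) sequentially"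
      using eventually_subseq[OF sm kkt_n] .
    show "(\<lambda>n. sgn (z (\<rho> n) - p (\<rho> n))) \<longlonglongrightarrow> w" using \<tau>(2) by (simp add: \<rho>_def)
  qed (use feas \<sigma>(2) \<sigma>_le in \<open>auto simp: \<rho>_def\<close>)
qed

section \<open>Limits of local minimizers\<close>

text \<open>The hypotheses at the fixed parameter, in the form in which they act:
  \<open>dual\<close> is LICQ, \<open>strict\<close> is strict complementarity, and
  \<open>nonsingular\<close> says that a kernel vector (v, -\<mu>) of the KKT matrix has
  \<open>v = 0\<close>.\<close>

locale nondegenerate_problem =
  fixes f :: "real^'m \<Rightarrow> real" and h :: "'k::finite \<Rightarrow> real^'m \<Rightarrow> real" and W :: "(real^'m) set"
  assumes f: "C2_on f W" and h: "\<And>i. C2_on (h i) W"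
    and dual: "\<And>y. (\<And>i. h i y \<le> 0) \<Longrightarrow> \<exists>e. dual_family {i. h i y = 0} (\<lambda>i. grad (h i) y) e"
    and strict: "\<And>y l i. KKT f h y l \<Longrightarrow> h i y = 0 \<Longrightarrow> 0 < l i"
    and nonsingular: "\<And>y l v \<mu>. KKT f h y l \<Longrightarrow> y \<in> W \<Longrightarrow>
       lagrangian_hess f h l y *v v = (\<Sum>i | h i y = 0. \<mu> i *\<^sub>R grad (h i) y) \<Longrightarrow>
       (\<And>i. h i y = 0 \<Longrightarrow> grad (h i) y \<bullet> v = 0) \<Longrightarrow> v = 0"
begin

text \<open>A nonzero tangent vector at which the form fails to be positive would be mapped by the
  Hessian into the span of the active gradients; with the coefficients as second block it would be a
  nonzero kernel vector of the KKT matrix.\<close>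

lemma definite_on_tangentI:
  assumes y: "y \<in> W" and kkt: "KKT f h y l"
    and psd: "\<And>v. (\<And>i. h i y = 0 \<Longrightarrow> grad (h i) y \<bullet> v = 0) \<Longrightarrow> 0 \<le> v \<bullet> (lagrangian_hess f h l y *v v)"
  shows "definite_on_tangent f h y l"
proof -
  define J where "J = {i. h i y = 0}"
  let ?M = "lagrangian_hess f h l y"
  obtain e where e: "dual_family J (\<lambda>i. grad (h i) y) e"
    using dual[of y] kkt unfolding KKT_def J_def by blast
  have sym: "u \<bullet> (?M *v v) = v \<bullet> (?M *v u)" for u v
    using hess_symmetric[OF C2_on_lagrangian(1)[where I = UNIV and l = l and h = h, OF f h] y, of u v]
      C2_on_lagrangian(3)[where I = UNIV and l = l and h = h, OF f h y]
    unfolding lagrangian_hess_def by simp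
  have "0 < v \<bullet> (?M *v v)" if "v \<noteq> 0" and v: "\<And>i. h i y = 0 \<Longrightarrow> grad (h i) y \<bullet> v = 0" for v
  proof (rule ccontr)
    assume "\<not> 0 < v \<bullet> (?M *v v)"
    then have le: "v \<bullet> (?M *v v) \<le> 0" by simp
    obtain \<mu> where "?M *v v = (\<Sum>j\<in>J. \<mu> j *\<^sub>R grad (h j) y)"
      by (rule semidefinite_null[OF sym e _ _ le]) (use v psd in \<open>auto simp: J_def\<close>)
    then have "v = 0" using nonsingular[OF kkt y _ v] unfolding J_def by blast
    then show False using that(1) by simp
  qed
  then show ?thesis unfolding definite_on_tangent_def by blast
qed

text \<open>One coercivity constant, inherited by the gradients at \<open>p n\<close>, does three
  things: it yields multipliers for the perturbed problems, bounds them, and bounds the dual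
  families used to carry tangent vectors from \<open>y\<close> to \<open>p n\<close>.\<close>

lemma local_min_limit:
  assumes F: "C2_converges F f W" and H: "\<And>i. C2_converges (\<lambda>n. H n i) (h i) W"
    and y: "y \<in> W" and lim: "p \<longlonglongrightarrow> y"
    and lm: "\<And>n. local_min (F n) (H n) (p n)"
  obtains l ls where "KKT f h y l" "\<And>i. (\<lambda>n. ls n i) \<longlonglongrightarrow> l i"
    "eventually (\<lambda>n. KKT (F n) (H n) (p n) (ls n)) sequentially"
    "eventually (\<lambda>n. \<forall>i. H n i (p n) = 0 \<longleftrightarrow> h i y = 0) sequentially"
    "definite_on_tangent f h y l"
proof -
  define J where "J = {i. h i y = 0}"
  define a where "a i = grad (h i) y" for i
  define b where "b n i = grad (H n i) (p n)" for n i
  define A where "A n = {i. H n i (p n) = 0}" for n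
  have fin: "finite I" for I :: "'k set" by simp
  note Hlim = C2_convergesD(4)[OF H y lim] and Flim = C2_convergesD(4)[OF F y lim]
  have b_lim: "(\<lambda>n. b n i) \<longlonglongrightarrow> a i" for i unfolding a_def b_def by (rule C2_convergesD(5)[OF H y lim])
  have Hle: "H n i (p n) \<le> 0" for n i using lm[of n] unfolding local_min_def by blast
  have feas: "h i y \<le> 0" for i
    by (rule tendsto_upperbound[OF Hlim always_eventually]) (simp_all add: Hle)
  obtain e where e: "dual_family J a e" using dual[OF feas] unfolding J_def a_def by blast
  obtain c where c: "c > 0" "coercive_family c J a" using dual_family_coercive[OF fin e] by blast
  have sub: "eventually (\<lambda>n. A n \<subseteq> J) sequentially"
  proof -
    have "eventually (\<lambda>n. i \<in> A n \<longrightarrow> i \<in> J) sequentially" for i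
    proof (cases "i \<in> J")
      case False
      then have "h i y < 0" using feas[of i] unfolding J_def by simp
      from order_tendstoD(2)[OF Hlim this] show ?thesis
        by (rule eventually_mono) (simp add: A_def)
    qed simp
    then have "eventually (\<lambda>n. \<forall>i. i \<in> A n \<longrightarrow> i \<in> J) sequentially" by (rule eventually_all_finite)
    then show ?thesis by (rule eventually_mono) blast
  qed
  \<comment> \<open>Half of \<open>c\<close> absorbs the error of the gradients; the remaining half
    is independent of n.\<close>
  have coercive: "eventually (\<lambda>n. coercive_family (c / 2) J (b n)) sequentially"
  proof -
    have "eventually (\<lambda>n. \<forall>i. dist (b n i) (a i) < c / 2) sequentially"
      using c(1) by (intro eventually_all_finite tendstoD[OF b_lim]) simp
    then show ?thesis
    proof eventually_elim
      case (elim n)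
      have "coercive_family (c - c / 2) J (b n)"
        by (rule coercive_family_perturb[OF c(2)]) (use elim in \<open>auto simp: dist_norm intro: less_imp_le\<close>)
      then show ?case by simp
    qed
  qed
  have ex: "eventually (\<lambda>n. \<exists>l. KKT (F n) (H n) (p n) l) sequentially"
    using sub coercive topological_tendstoD[OF lim C2_convergesD(3)[OF F] y]
  proof eventually_elim
    case (elim n)
    have "coercive_family (c / 2) (A n) (b n)"
      by (rule coercive_family_subset[OF elim(2,1) fin])
    then obtain e' where "dual_family (A n) (b n) e'"
      using coercive_family_dual[OF fin] c(1) by (metis half_gt_zero)
    then show ?case
      using first_order_necessary[where f = "F n" and h = "H n", OF C2_convergesD(2)[OF F] C2_convergesD(2)[OF H] elim(3) lm]
      unfolding A_def b_def by blast
  qed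
  then obtain ls where kkt_n: "eventually (\<lambda>n. KKT (F n) (H n) (p n) (ls n)) sequentially"
    by (rule eventually_choice)
  have Fgrad: "(\<lambda>n. grad (F n) (p n)) \<longlonglongrightarrow> grad f y" by (rule C2_convergesD(5)[OF F y lim])
  have support: "eventually (\<lambda>n. (\<forall>i. i \<notin> J \<longrightarrow> ls n i = 0) \<and>
      (\<Sum>i\<in>J. ls n i *\<^sub>R b n i) = - grad (F n) (p n)) sequentially"
    using kkt_n sub
  proof eventually_elim
    case (elim n)
    then have 0: "ls n i = 0" if "i \<notin> J" for i using that unfolding KKT_def A_def by auto
    then have "(\<Sum>i\<in>J. ls n i *\<^sub>R b n i) = (\<Sum>i\<in>UNIV. ls n i *\<^sub>R b n i)"
      by (intro sum.mono_neutral_left) auto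
    then show ?case using 0 elim(1) unfolding KKT_def b_def by (simp add: add_eq_0_iff)
  qed
  \<comment> \<open>Stationarity at \<open>p n\<close> and coercivity with \<open>c / 2\<close>
    bound the multipliers by \<open>2 / c\<close> times the gradient norm of \<open>F n\<close>; the
    1 leaves room for that norm to exceed its limit.\<close>
  define B where "B = 2 / c * (norm (grad f y) + 1)"
  have bound: "eventually (\<lambda>n. \<forall>i\<in>J. \<bar>ls n i\<bar> \<le> B) sequentially"
  proof -
    have "norm (grad f y) < norm (grad f y) + 1" by simp
    from order_tendstoD(2)[OF tendsto_norm[OF Fgrad] this] show ?thesis
      using coercive support
    proof eventually_elim
      case (elim n)
      have "c / 2 * (\<Sum>i\<in>J. \<bar>ls n i\<bar>) \<le> norm (grad f y) + 1"
      proof -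
        have "c / 2 * (\<Sum>i\<in>J. \<bar>ls n i\<bar>) \<le> norm (\<Sum>i\<in>J. ls n i *\<^sub>R b n i)"
          using elim(2) unfolding coercive_family_def by blast
        then show ?thesis using elim(1,3) by simp
      qed
      then have "(\<Sum>i\<in>J. \<bar>ls n i\<bar>) \<le> B" unfolding B_def using c(1) by (simp add: field_simps)
      moreover have "\<bar>ls n i\<bar> \<le> (\<Sum>i\<in>J. \<bar>ls n i\<bar>)" if "i \<in> J" for i
        using that by (intro member_le_sum) auto
      ultimately show ?case by fastforce
    qed
  qed
  \<comment> \<open>Pairing stationarity at \<open>y\<close> with \<open>e i\<close> forces this
    value. Naming the limit in advance gives convergence of the whole sequence, with no
    subsequence.\<close>
  define l where "l i = (if i \<in> J then - (grad f y \<bullet> e i) else 0)" for i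
  have ls_lim: "(\<lambda>n. ls n i) \<longlonglongrightarrow> l i" for i
  proof (cases "i \<in> J")
    case False
    then have "eventually (\<lambda>n. 0 = ls n i) sequentially" by (intro eventually_mono[OF support]) auto
    then have "(\<lambda>n. ls n i) \<longlonglongrightarrow> 0" by (rule Lim_transform_eventually[OF tendsto_const])
    then show ?thesis using False unfolding l_def by simp
  next
    case True
    \<comment> \<open>Pairing the perturbed equation with the fixed \<open>e i\<close> leaves this
      error: bounded multipliers times vanishing gradient differences.\<close>
    have null: "(\<lambda>n. ls n j * ((b n j - a j) \<bullet> e i)) \<longlonglongrightarrow> 0" if "j \<in> J" for j
    proof (rule Lim_null_comparison)
      show "eventually (\<lambda>n. norm (ls n j * ((b n j - a j) \<bullet> e i)) \<le> B * \<bar>(b n j - a j) \<bullet> e i\<bar>) sequentially"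
        using bound by (rule eventually_mono) (use that in \<open>auto simp: abs_mult mult_right_mono\<close>)
      have "(\<lambda>n. B * \<bar>(b n j - a j) \<bullet> e i\<bar>) \<longlonglongrightarrow> B * \<bar>(a j - a j) \<bullet> e i\<bar>"
        by (intro tendsto_intros b_lim)
      then show "(\<lambda>n. B * \<bar>(b n j - a j) \<bullet> e i\<bar>) \<longlonglongrightarrow> 0" by simp
    qed
    have "(\<lambda>n. - (grad (F n) (p n) \<bullet> e i) - (\<Sum>j\<in>J. ls n j * ((b n j - a j) \<bullet> e i)))
        \<longlonglongrightarrow> - (grad f y \<bullet> e i) - (\<Sum>j\<in>J. 0)"
      by (intro tendsto_diff tendsto_minus tendsto_inner Fgrad tendsto_const tendsto_sum null)
    then have "(\<lambda>n. - (grad (F n) (p n) \<bullet> e i) - (\<Sum>j\<in>J. ls n j * ((b n j - a j) \<bullet> e i))) \<longlonglongrightarrow> l i"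
      using True by (simp add: l_def)
    then show ?thesis
    proof (rule Lim_transform_eventually)
      show "eventually (\<lambda>n. - (grad (F n) (p n) \<bullet> e i) - (\<Sum>j\<in>J. ls n j * ((b n j - a j) \<bullet> e i)) = ls n i) sequentially"
        using support
      proof (rule eventually_mono, elim conjE)
        fix n assume "(\<Sum>j\<in>J. ls n j *\<^sub>R b n j) = - grad (F n) (p n)"
        then have "(\<Sum>j\<in>J. ls n j *\<^sub>R b n j) \<bullet> e i = - (grad (F n) (p n) \<bullet> e i)" by simp
        then have "- (grad (F n) (p n) \<bullet> e i) = (\<Sum>j\<in>J. ls n j * (b n j \<bullet> e i))"
          by (simp add: inner_sum_left)
        then have "- (grad (F n) (p n) \<bullet> e i) - (\<Sum>j\<in>J. ls n j * ((b n j - a j) \<bullet> e i)) = (\<Sum>j\<in>J. ls n j * (a j \<bullet> e i))"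
          by (simp add: sum_subtractf[symmetric] inner_diff_left algebra_simps)
        also have "\<dots> = (\<Sum>j\<in>J. ls n j * (if j = i then 1 else 0))"
          using e True unfolding dual_family_def by (intro sum.cong) auto
        also have "\<dots> = ls n i" using True by (simp add: if_distrib cong: if_cong)
        finally show "- (grad (F n) (p n) \<bullet> e i) - (\<Sum>j\<in>J. ls n j * ((b n j - a j) \<bullet> e i)) = ls n i" .
      qed
    qed
  qed
  have kkt: "KKT f h y l"
  proof -
    have "(\<lambda>n. grad (F n) (p n) + (\<Sum>i\<in>UNIV. ls n i *\<^sub>R b n i)) \<longlonglongrightarrow> grad f y + (\<Sum>i\<in>UNIV. l i *\<^sub>R a i)"
      by (intro tendsto_add Fgrad tendsto_sum tendsto_scaleR ls_lim b_lim)
    moreover have "(\<lambda>n. grad (F n) (p n) + (\<Sum>i\<in>UNIV. ls n i *\<^sub>R b n i)) \<longlonglongrightarrow> 0"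
      by (rule tendsto_eventually) (rule eventually_mono[OF kkt_n], simp add: KKT_def b_def)
    ultimately have "grad f y + (\<Sum>i\<in>UNIV. l i *\<^sub>R a i) = 0" by (rule LIMSEQ_unique)
    moreover have "0 \<le> l i" for i
    proof (rule tendsto_lowerbound[OF ls_lim])
      show "eventually (\<lambda>n. 0 \<le> ls n i) sequentially"
        using kkt_n by (rule eventually_mono) (simp add: KKT_def)
    qed simp
    ultimately show ?thesis using feas unfolding KKT_def a_def by (simp add: l_def J_def)
  qed
  \<comment> \<open>A constraint active at \<open>y\<close> has a positive limit multiplier, so
    \<open>ls n i\<close> is eventually positive and complementary slackness makes the constraint
    active at \<open>p n\<close>.\<close>
  have active: "eventually (\<lambda>n. A n = J) sequentially"
  proof -
    have "eventually (\<lambda>n. i \<in> J \<longrightarrow> i \<in> A n) sequentially" for i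
    proof (cases "i \<in> J")
      case True
      then have "0 < l i" using strict[OF kkt] unfolding J_def by simp
      from order_tendstoD(1)[OF ls_lim this] kkt_n show ?thesis
      proof eventually_elim
        case (elim n)
        then have "ls n i * H n i (p n) = 0" unfolding KKT_def by blast
        then show ?case using elim(1) by (simp add: A_def)
      qed
    qed simp
    then have "eventually (\<lambda>n. \<forall>i. i \<in> J \<longrightarrow> i \<in> A n) sequentially" by (rule eventually_all_finite)
    with sub show ?thesis by eventually_elim blast
  qed
  have psd: "0 \<le> v \<bullet> (lagrangian_hess f h l y *v v)" if v: "\<And>i. h i y = 0 \<Longrightarrow> grad (h i) y \<bullet> v = 0" for v
  proof -
    have "eventually (\<lambda>n. \<exists>e. dual_family J (b n) e \<and> (\<forall>j\<in>J. norm (e j) \<le> 2 / c)) sequentially"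
      using coercive
    proof eventually_elim
      case (elim n)
      then obtain e' where "dual_family J (b n) e'" "\<And>j. j \<in> J \<Longrightarrow> norm (e' j) \<le> 1 / (c / 2)"
        using coercive_family_dual[OF fin, of "c / 2" J "b n"] c(1) by auto
      then show ?case by auto
    qed
    then obtain E where E: "eventually (\<lambda>n. dual_family J (b n) (E n) \<and> (\<forall>j\<in>J. norm (E n j) \<le> 2 / c)) sequentially"
      by (rule eventually_choice)
    \<comment> \<open>The second-order condition at \<open>p n\<close> needs vectors tangent to the
      perturbed active constraints. Correcting \<open>v\<close> along the dual vectors makes it
      tangent, and boundedness of the dual vectors makes the correction vanish.\<close>
    define u where "u n = v - (\<Sum>j\<in>J. (b n j \<bullet> v) *\<^sub>R E n j)" for n
    have null: "(\<lambda>n. (b n j \<bullet> v) *\<^sub>R E n j) \<longlonglongrightarrow> 0" if j: "j \<in> J" for j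
    proof (rule Lim_null_comparison)
      show "eventually (\<lambda>n. norm ((b n j \<bullet> v) *\<^sub>R E n j) \<le> \<bar>b n j \<bullet> v\<bar> * (2 / c)) sequentially"
        using E
      proof (rule eventually_mono, elim conjE)
        fix n assume "\<forall>j\<in>J. norm (E n j) \<le> 2 / c"
        then have "\<bar>b n j \<bullet> v\<bar> * norm (E n j) \<le> \<bar>b n j \<bullet> v\<bar> * (2 / c)"
          using j by (intro mult_left_mono) auto
        then show "norm ((b n j \<bullet> v) *\<^sub>R E n j) \<le> \<bar>b n j \<bullet> v\<bar> * (2 / c)" unfolding norm_scaleR .
      qed
      have "(\<lambda>n. \<bar>b n j \<bullet> v\<bar> * (2 / c)) \<longlonglongrightarrow> \<bar>a j \<bullet> v\<bar> * (2 / c)"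
        by (rule tendsto_mult[OF tendsto_rabs[OF tendsto_inner[OF b_lim tendsto_const]] tendsto_const])
      moreover have "a j \<bullet> v = 0" using v j unfolding a_def J_def by simp
      ultimately show "(\<lambda>n. \<bar>b n j \<bullet> v\<bar> * (2 / c)) \<longlonglongrightarrow> 0" by simp
    qed
    have "u \<longlonglongrightarrow> v - (\<Sum>j\<in>J. 0)" unfolding u_def by (intro tendsto_diff tendsto_const tendsto_sum null)
    then have u_lim: "u \<longlonglongrightarrow> v" by simp
    have "eventually (\<lambda>n. 0 \<le> u n \<bullet> (lagrangian_hess (F n) (H n) (ls n) (p n) *v u n)) sequentially"
      using E active kkt_n topological_tendstoD[OF lim C2_convergesD(3)[OF F] y]
    proof eventually_elim
      case (elim n)
      show ?case
      proof (rule second_order_necessary[where f = "F n" and h = "H n", OF C2_convergesD(2)[OF F] C2_convergesD(2)[OF H] elim(4) lm _ elim(3)])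
        show "dual_family {i. H n i (p n) = 0} (\<lambda>i. grad (H n i) (p n)) (E n)"
          using elim(1,2) unfolding A_def b_def by simp
        fix i assume "H n i (p n) = 0"
        then have "i \<in> J" using elim(2) unfolding A_def by blast
        then have "b n i \<bullet> u n = 0" unfolding u_def inner_diff_right
          using dual_family_sum[OF fin, of J "b n" "E n" i "\<lambda>j. b n j \<bullet> v"] elim(1) by simp
        then show "grad (H n i) (p n) \<bullet> u n = 0" unfolding b_def .
      qed
    qed
    moreover have "(\<lambda>n. u n \<bullet> (lagrangian_hess (F n) (H n) (ls n) (p n) *v u n)) \<longlonglongrightarrow> v \<bullet> (lagrangian_hess f h l y *v v)"
      by (rule tendsto_inner[OF u_lim tendsto_matrix_vector_mult[OF lagrangian_hess_tendsto[OF F H y lim ls_lim] u_lim]])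
    ultimately show ?thesis by (intro tendsto_lowerbound[where F = sequentially]) auto
  qed
  have "eventually (\<lambda>n. \<forall>i. H n i (p n) = 0 \<longleftrightarrow> h i y = 0) sequentially"
    using active by (rule eventually_mono) (auto simp: A_def J_def)
  then show thesis
    using that[OF kkt ls_lim kkt_n] definite_on_tangentI[OF y kkt psd] by blast
qed

end

section \<open>Local minimizers under small perturbations\<close>

text \<open>Hessians are compared in the Euclidean norm on matrices, the one behind
  \<open>uniform_limit\<close>; the operator norm in \<open>C2_norm\<close> is converted in
  \<open>C2_close_add\<close>.\<close>

definition C2_close :: "real \<Rightarrow> (real^'m \<Rightarrow> real) \<Rightarrow> (real^'m \<Rightarrow> real) \<Rightarrow> (real^'m) set \<Rightarrow> bool" where
  "C2_close \<epsilon> F f W \<longleftrightarrow> C2_on F W \<and>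
     (\<forall>y\<in>W. \<bar>F y - f y\<bar> \<le> \<epsilon> \<and> norm (grad F y - grad f y) \<le> \<epsilon> \<and> norm (hess F y - hess f y) \<le> \<epsilon>)"

lemma C2_close_mono: "C2_close \<epsilon> F f W \<Longrightarrow> \<epsilon> \<le> \<epsilon>' \<Longrightarrow> C2_close \<epsilon>' F f W"
  unfolding C2_close_def by force

lemma uniform_limit_inverse_Suc:
  fixes f :: "'a \<Rightarrow> 'b::real_normed_vector"
  assumes "\<And>n y. y \<in> W \<Longrightarrow> norm (F n y - f y) \<le> inverse (real (Suc n))"
  shows "uniform_limit W F f sequentially"
proof (rule uniform_limitI)
  fix e :: real assume "e > 0"
  from order_tendstoD(2)[OF LIMSEQ_inverse_real_of_nat this]
  show "eventually (\<lambda>n. \<forall>y\<in>W. dist (F n y) (f y) < e) sequentially"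
    by (rule eventually_mono) (use assms in \<open>auto simp: dist_norm intro: le_less_trans\<close>)
qed

lemma C2_close_converges:
  assumes "C2_on f W" "\<And>n. C2_close (inverse (real (Suc n))) (F n) f W"
  shows "C2_converges F f W"
  unfolding C2_converges_def
  by (intro conjI allI uniform_limit_inverse_Suc assms(1))
    (use assms(2) in \<open>auto simp: C2_close_def simp del: of_nat_Suc\<close>)

lemma inverse_Suc_tendsto:
  fixes p :: "nat \<Rightarrow> 'v::metric_space"
  assumes "\<And>n. dist (p n) y < inverse (real (Suc n))"
  shows "p \<longlonglongrightarrow> y"
  by (rule metric_tendsto_imp_tendsto[OF LIMSEQ_inverse_real_of_nat])
    (use assms in \<open>auto intro!: always_eventually less_imp_le simp: dist_real_def simp del: of_nat_Suc\<close>)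

context nondegenerate_problem
begin

definition near :: "real \<Rightarrow> (real^'m \<Rightarrow> real) \<Rightarrow> ('k \<Rightarrow> real^'m \<Rightarrow> real) \<Rightarrow> bool" where
  "near \<epsilon> F H \<longleftrightarrow> C2_close \<epsilon> F f W \<and> (\<forall>i. C2_close \<epsilon> (H i) (h i) W)"

lemma near_mono: "near \<epsilon> F H \<Longrightarrow> \<epsilon> \<le> \<epsilon>' \<Longrightarrow> near \<epsilon>' F H"
  unfolding near_def using C2_close_mono by blast

lemma near_self: "0 \<le> \<epsilon> \<Longrightarrow> near \<epsilon> f h"
  unfolding near_def C2_close_def using f h by simp

lemma near_converges:
  assumes "\<And>n. near (inverse (real (Suc n))) (F n) (H n)"
  shows "C2_converges F f W" "\<And>i. C2_converges (\<lambda>n. H n i) (h i) W"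
  using assms unfolding near_def by (auto intro!: C2_close_converges f h simp del: of_nat_Suc)

text \<open>The growth estimate for the constant problem and constant base point \<open>y\<close>,
  against feasible points approaching \<open>y\<close>.\<close>

lemma strict_local_min:
  assumes y: "y \<in> W" and kkt: "KKT f h y l" and pd: "definite_on_tangent f h y l"
  shows "\<exists>\<rho>>0. \<forall>z. (\<forall>i. h i z \<le> 0) \<longrightarrow> dist z y < \<rho> \<longrightarrow> z \<noteq> y \<longrightarrow> f y < f z"
    and "local_min f h y"
proof -
  show *: "\<exists>\<rho>>0. \<forall>z. (\<forall>i. h i z \<le> 0) \<longrightarrow> dist z y < \<rho> \<longrightarrow> z \<noteq> y \<longrightarrow> f y < f z"
  proof (rule ccontr)
    assume "\<not> ?thesis"
    then have "\<forall>n. \<exists>z. (\<forall>i. h i z \<le> 0) \<and> dist z y < inverse (real (Suc n)) \<and> z \<noteq> y \<and> \<not> f y < f z"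
      by (metis inverse_positive_iff_positive of_nat_0_less_iff zero_less_Suc)
    then obtain z where z: "\<And>n i. h i (z n) \<le> 0" "\<And>n. dist (z n) y < inverse (real (Suc n))"
      "\<And>n. z n \<noteq> y" "\<And>n. \<not> f y < f (z n)" by metis
    have "eventually (\<lambda>n. z n = y \<or> f y < f (z n)) sequentially"
      using eventually_growth[where F = "\<lambda>_. f" and H = "\<lambda>_. h" and ls = "\<lambda>_. l" and p = "\<lambda>_. y",
          OF C2_converges_const[OF f] C2_converges_const[OF h] y tendsto_const inverse_Suc_tendsto[OF z(2)]
            tendsto_const kkt _ strict[OF kkt] pd z(1)] kkt by simp
    then show False using z(3,4) by simp
  qed
  then obtain \<rho> where \<rho>: "\<rho> > 0" "\<And>z. (\<forall>i. h i z \<le> 0) \<Longrightarrow> dist z y < \<rho> \<Longrightarrow> z \<noteq> y \<Longrightarrow> f y < f z"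
    by blast
  have "f y \<le> f z" if "\<forall>i. h i z \<le> 0" "dist z y < \<rho>" for z
    using \<rho>(2)[OF that] by (cases "z = y") (auto intro: less_imp_le)
  then show "local_min f h y" using kkt \<rho>(1) unfolding local_min_def KKT_def by blast
qed

lemma local_min_second_order:
  assumes "y \<in> W" "local_min f h y"
  obtains l where "KKT f h y l" "definite_on_tangent f h y l"
proof -
  obtain l ls where "KKT f h y l" "definite_on_tangent f h y l"
    by (rule local_min_limit[where F = "\<lambda>_. f" and H = "\<lambda>_. h" and p = "\<lambda>_. y",
          OF C2_converges_const[OF f] C2_converges_const[OF h] assms(1) tendsto_const assms(2)])
  then show thesis using that by blast
qed

text \<open>The growth estimate is applied twice, with the roles of the two perturbed minimizers
  exchanged; distinct points would give contradictory strict inequalities. The point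
  \<open>y\<close> is arbitrary in \<open>W\<close>: that it is a local minimizer is part of the
  conclusion, so the radii can be used in a covering argument. One \<open>\<rho>\<close> bounds both
  the perturbation and the distance.\<close>

lemma local_min_rigid:
  assumes y: "y \<in> W"
  obtains \<rho> where "\<rho> > 0"
    "\<And>F H p q. near \<rho> F H \<Longrightarrow> local_min F H p \<Longrightarrow> local_min F H q \<Longrightarrow> dist p y < \<rho> \<Longrightarrow> dist q y < \<rho> \<Longrightarrow>
       p = q \<and> {i. H i p = 0} = {i. h i y = 0} \<and> local_min f h y"
proof -
  define Q where "Q \<rho> F H p q \<longleftrightarrow> near \<rho> F H \<and> local_min F H p \<and> local_min F H q \<and> dist p y < \<rho> \<and> dist q y < \<rho> \<and>
       \<not> (p = q \<and> {i. H i p = 0} = {i. h i y = 0} \<and> local_min f h y)" for \<rho> F H p q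
  have "\<exists>\<rho>>0. \<forall>F H p q. \<not> Q \<rho> F H p q"
  proof (rule ccontr)
    assume "\<not> ?thesis"
    then have "\<exists>F H p q. Q (inverse (real (Suc n))) F H p q" for n
      by (metis inverse_positive_iff_positive of_nat_0_less_iff zero_less_Suc)
    then obtain F H p q where Q: "Q (inverse (real (Suc n))) (F n) (H n) (p n) (q n)" for n
      by metis
    have *: "near (inverse (real (Suc n))) (F n) (H n)"
      "local_min (F n) (H n) (p n)" "local_min (F n) (H n) (q n)"
      "dist (p n) y < inverse (real (Suc n))" "dist (q n) y < inverse (real (Suc n))"
      "\<not> (p n = q n \<and> {i. H n i (p n) = 0} = {i. h i y = 0} \<and> local_min f h y)" for n
      using Q[of n] unfolding Q_def by blast+
    note conv = near_converges[OF *(1)]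
    note p = inverse_Suc_tendsto[OF *(4)] and q = inverse_Suc_tendsto[OF *(5)]
    have feas: "H n i (p n) \<le> 0" "H n i (q n) \<le> 0" for n i
      using *(2,3) unfolding local_min_def by blast+
    obtain l ls where l: "KKT f h y l" "\<And>i. (\<lambda>n. ls n i) \<longlonglongrightarrow> l i"
      "eventually (\<lambda>n. KKT (F n) (H n) (p n) (ls n)) sequentially"
      "eventually (\<lambda>n. \<forall>i. H n i (p n) = 0 \<longleftrightarrow> h i y = 0) sequentially"
      "definite_on_tangent f h y l"
      by (rule local_min_limit[OF conv y p *(2)]) (rule that)
    obtain l' ls' where l': "KKT f h y l'" "\<And>i. (\<lambda>n. ls' n i) \<longlonglongrightarrow> l' i"
      "eventually (\<lambda>n. KKT (F n) (H n) (q n) (ls' n)) sequentially"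
      "eventually (\<lambda>n. \<forall>i. H n i (q n) = 0 \<longleftrightarrow> h i y = 0) sequentially"
      "definite_on_tangent f h y l'"
      by (rule local_min_limit[OF conv y q *(3)]) (rule that)
    have 1: "eventually (\<lambda>n. q n = p n \<or> F n (p n) < F n (q n)) sequentially"
      by (rule eventually_growth[OF conv y p q l(2,1,3) strict[OF l(1)] l(5) feas(2)])
    have 2: "eventually (\<lambda>n. p n = q n \<or> F n (q n) < F n (p n)) sequentially"
      by (rule eventually_growth[OF conv y q p l'(2,1,3) strict[OF l'(1)] l'(5) feas(1)])
    have lm: "local_min f h y"
      by (rule strict_local_min(2)[OF y l(1,5)])
    have "eventually (\<lambda>n::nat. False) sequentially"
      using 1 2 l(4)
    proof eventually_elim
      case (elim n)
      then have "p n = q n" by auto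
      moreover have "{i. H n i (p n) = 0} = {i. h i y = 0}" using elim by blast
      ultimately show False using *(6)[of n] lm by blast
    qed
    then show False by simp
  qed
  then obtain \<rho> where "\<rho> > 0" "\<And>F H p q. \<not> Q \<rho> F H p q" by blast
  then show thesis using that[of \<rho>] unfolding Q_def by blast
qed

text \<open>Perturbed minimizers in \<open>K\<close> outside \<open>U\<close> would accumulate at a
  point of \<open>K\<close> that is a local minimizer of the original problem, hence in the open set
  \<open>U\<close>.\<close>

lemma local_min_near:
  assumes K: "compact K" "K \<subseteq> W" and U: "open U" "\<And>y. local_min f h y \<Longrightarrow> y \<in> U"
  obtains \<epsilon> where "\<epsilon> > 0" "\<And>F H p. near \<epsilon> F H \<Longrightarrow> local_min F H p \<Longrightarrow> p \<in> K \<Longrightarrow> p \<in> U"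
proof -
  define Q where "Q \<epsilon> F H p \<longleftrightarrow> near \<epsilon> F H \<and> local_min F H p \<and> p \<in> K \<and> p \<notin> U" for \<epsilon> F H p
  have "\<exists>\<epsilon>>0. \<forall>F H p. \<not> Q \<epsilon> F H p"
  proof (rule ccontr)
    assume "\<not> ?thesis"
    then have "\<exists>F H p. Q (inverse (real (Suc n))) F H p" for n
      by (metis inverse_positive_iff_positive of_nat_0_less_iff zero_less_Suc)
    then obtain F H p where Q: "Q (inverse (real (Suc n))) (F n) (H n) (p n)" for n
      by metis
    have *: "near (inverse (real (Suc n))) (F n) (H n)"
      "local_min (F n) (H n) (p n)" "p n \<in> K" "p n \<notin> U" for n
      using Q[of n] unfolding Q_def by blast+
    obtain y \<tau> where \<tau>: "strict_mono \<tau>" "(\<lambda>n. p (\<tau> n)) \<longlonglongrightarrow> y" "y \<in> K"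
      by (rule compact_subsequence[OF K(1) *(3)])
    then have y: "y \<in> W" using K(2) by blast
    obtain l ls where l: "KKT f h y l" "definite_on_tangent f h y l"
      by (rule local_min_limit[where F = "\<lambda>n. F (\<tau> n)" and H = "\<lambda>n. H (\<tau> n)" and p = "\<lambda>n. p (\<tau> n)",
            OF C2_converges_subseq[OF near_converges(1)[OF *(1)] \<tau>(1)]
              C2_converges_subseq[OF near_converges(2)[OF *(1)] \<tau>(1)] y \<tau>(2) *(2)])
    have "local_min f h y"
      by (rule strict_local_min(2)[OF y l])
    then have "eventually (\<lambda>n. p (\<tau> n) \<in> U) sequentially"
      using topological_tendstoD[OF \<tau>(2) U(1)] U(2) by blast
    then show False using *(4) by simp
  qed
  then obtain \<epsilon> where "\<epsilon> > 0" "\<And>F H p. \<not> Q \<epsilon> F H p" by blast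
  then show thesis using that[of \<epsilon>] unfolding Q_def by blast
qed

lemma strictly_feasible_direction:
  assumes y: "y \<in> W" and feas: "\<And>i. h i y \<le> 0"
  obtains v where "\<And>i. eventually (\<lambda>t. h i (y + t *\<^sub>R v) < 0) (at_right 0)"
proof -
  define J where "J = {i. h i y = 0}"
  obtain e where e: "dual_family J (\<lambda>i. grad (h i) y) e"
    using dual[OF feas] unfolding J_def by blast
  define v where "v = (\<Sum>j\<in>J. (-1) *\<^sub>R e j)"
  have "eventually (\<lambda>t. h i (y + t *\<^sub>R v) < 0) (at_right 0)" for i
  proof (cases "i \<in> J")
    case True
    have "grad (h i) y \<bullet> v = -1"
      unfolding v_def using dual_family_sum[OF _ e True, of "\<lambda>_. -1"] by simp
    then show ?thesis using decrease_right[OF h y, of i v] True unfolding J_def by simp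
  next
    case False
    then have "h i y < 0" using feas[of i] unfolding J_def by simp
    then show ?thesis using order_tendstoD(2)[OF line_tendsto[OF h y, where d=v and e=0]] by simp
  qed
  then show thesis using that by blast
qed

text \<open>The obstacle is that \<open>y\<close> itself may be infeasible after perturbation, so it
  cannot serve as competitor. Strictly feasible points \<open>y + t *\<^sub>R v\<close> replace it:
  for fixed \<open>t\<close> they survive small perturbations, and \<open>t\<close> tends to 0 only
  after n has tended to infinity.\<close>

lemma local_min_persists:
  assumes y: "y \<in> W" and lm: "local_min f h y" and \<rho>: "\<rho> > 0"
  obtains \<epsilon> where "\<epsilon> > 0" "\<And>F H. near \<epsilon> F H \<Longrightarrow> \<exists>p. local_min F H p \<and> dist p y < \<rho>"
proof -
  define Q where "Q \<epsilon> F H \<longleftrightarrow> near \<epsilon> F H \<and> (\<forall>p. local_min F H p \<longrightarrow> \<not> dist p y < \<rho>)" for \<epsilon> F H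
  have feas: "h i y \<le> 0" for i using lm unfolding local_min_def by blast
  obtain l where l: "KKT f h y l" "definite_on_tangent f h y l"
    by (rule local_min_second_order[OF y lm])
  obtain r1 where r1: "r1 > 0" "\<And>z. (\<forall>i. h i z \<le> 0) \<Longrightarrow> dist z y < r1 \<Longrightarrow> z \<noteq> y \<Longrightarrow> f y < f z"
    using strict_local_min(1)[OF y l] by blast
  obtain r2 where r2: "r2 > 0" "ball y r2 \<subseteq> W"
    using C2_on_D(1)[OF f] y openE by blast
  \<comment> \<open>Below \<open>\<rho>\<close> a minimizer inside the ball is one of those sought,
    below \<open>r1\<close> the sphere lies in the region of strict minimality, and below
    \<open>r2\<close> the closed ball lies in \<open>W\<close>.\<close>
  obtain r where "0 < r" "r < min \<rho> (min r1 r2)"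
    using dense[of 0 "min \<rho> (min r1 r2)"] \<rho> r1(1) r2(1) by auto
  then have r: "r > 0" "r < \<rho>" "r < r1" "r < r2" by auto
  then have "cball y r \<subseteq> ball y r2" by auto
  then have cW: "cball y r \<subseteq> W" using r2(2) by blast
  obtain v where v: "\<And>i. eventually (\<lambda>t. h i (y + t *\<^sub>R v) < 0) (at_right 0)"
    by (rule strictly_feasible_direction[OF y feas]) (rule that)
  have toy: "((\<lambda>t. y + t *\<^sub>R v) \<longlongrightarrow> y) (at_right 0)"
  proof -
    have "((\<lambda>t. y + t *\<^sub>R v) \<longlongrightarrow> y + 0 *\<^sub>R v) (at_right 0)" by (intro tendsto_intros)
    then show ?thesis by simp
  qed
  define G where "G t \<longleftrightarrow> (\<forall>i. h i (y + t *\<^sub>R v) < 0) \<and> y + t *\<^sub>R v \<in> ball y r" for t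
  have G: "eventually G (at_right 0)"
    unfolding G_def[abs_def]
    by (rule eventually_conj[OF eventually_all_finite[OF v] topological_tendstoD[OF toy]]) (use r(1) in auto)
  have "\<exists>\<epsilon>>0. \<forall>F H. \<not> Q \<epsilon> F H"
  proof (rule ccontr)
    assume "\<not> ?thesis"
    then have "\<exists>F H. Q (inverse (real (Suc n))) F H" for n
      by (metis inverse_positive_iff_positive of_nat_0_less_iff zero_less_Suc)
    then obtain F H where Q: "Q (inverse (real (Suc n))) (F n) (H n)" for n
      by metis
    have near: "near (inverse (real (Suc n))) (F n) (H n)" for n
      using Q[of n] unfolding Q_def by blast
    have none: "\<not> dist p y < \<rho>" if "local_min (F n) (H n) p" for n p
      using Q[of n] that unfolding Q_def by blast
    note conv = near_converges[OF near]
    define C where "C n = {z \<in> cball y r. \<forall>i. H n i z \<le> 0}" for n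
    have inC: "eventually (\<lambda>n. y + t *\<^sub>R v \<in> C n) sequentially" if "G t" for t
    proof -
      have yt: "y + t *\<^sub>R v \<in> cball y r" "y + t *\<^sub>R v \<in> W" using that cW unfolding G_def by auto
      have "eventually (\<lambda>n. H n i (y + t *\<^sub>R v) < 0) sequentially" for i
        using that unfolding G_def
        by (intro order_tendstoD(2)[OF C2_convergesD(4)[OF conv(2) yt(2) tendsto_const]]) blast
      then have "eventually (\<lambda>n. \<forall>i. H n i (y + t *\<^sub>R v) < 0) sequentially" by (rule eventually_all_finite)
      then show ?thesis
        by (rule eventually_mono) (use yt in \<open>auto simp: C_def intro: less_imp_le\<close>)
    qed
    obtain t0 where t0: "G t0" using eventually_happens[OF G] by auto
    have "eventually (\<lambda>n. \<exists>z. z \<in> C n \<and> (\<forall>w\<in>C n. F n z \<le> F n w)) sequentially"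
      using inC[OF t0]
    proof (rule eventually_mono)
      fix n assume "y + t0 *\<^sub>R v \<in> C n"
      then have ne: "C n \<noteq> {}" by blast
      have "C n = cball y r \<inter> (\<Inter>i. {z \<in> cball y r. H n i z \<le> 0})" unfolding C_def by blast
      also have "compact \<dots>"
        using cW C2_on_D(2)[OF C2_convergesD(2)[OF conv(2)]]
        by (intro compact_Int_closed closed_INT ballI continuous_on_closed_Collect_le continuous_on_const)
          (auto intro: continuous_on_subset)
      finally have "compact (C n)" .
      moreover have "continuous_on (C n) (F n)"
        by (rule continuous_on_subset[OF C2_on_D(2)[OF C2_convergesD(2)[OF conv(1)]]])
          (use cW in \<open>auto simp: C_def\<close>)
      ultimately show "\<exists>z. z \<in> C n \<and> (\<forall>w\<in>C n. F n z \<le> F n w)"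
        using continuous_attains_inf[of "C n" "F n"] ne by blast
    qed
    then obtain z where z: "eventually (\<lambda>n. z n \<in> C n \<and> (\<forall>w\<in>C n. F n (z n) \<le> F n w)) sequentially"
      by (rule eventually_choice)
    \<comment> \<open>A minimizer over the closed ball that is interior to it is an unrestricted
      local minimizer, which the assumed failure excludes.\<close>
    have boundary: "dist (z n) y = r" if z: "z n \<in> C n" "\<forall>w\<in>C n. F n (z n) \<le> F n w" for n
    proof (rule ccontr)
      assume "dist (z n) y \<noteq> r"
      then have lt: "dist (z n) y < r" using z(1) unfolding C_def by (simp add: dist_commute)
      have "F n (z n) \<le> F n w" if w: "\<forall>i. H n i w \<le> 0" "dist w (z n) < r - dist (z n) y" for w
      proof -
        have "dist w y \<le> r" using w(2) dist_triangle[of w y "z n"] by simp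
        then have "w \<in> C n" using w(1) unfolding C_def by (simp add: dist_commute)
        then show ?thesis using z(2) by blast
      qed
      moreover have "r - dist (z n) y > 0" using lt by simp
      moreover have "\<forall>i. H n i (z n) \<le> 0" using z(1) unfolding C_def by simp
      ultimately have "local_min (F n) (H n) (z n)" unfolding local_min_def by blast
      then show False using none lt r(2) by fastforce
    qed
    \<comment> \<open>The default \<open>y\<close> keeps every term in the ball, as
      \<open>compact_subsequence\<close> requires; it is eventually not taken.\<close>
    define z' where "z' n = (if z n \<in> C n then z n else y)" for n
    have "z' n \<in> cball y r" for n using r(1) unfolding z'_def C_def by auto
    then obtain q \<tau> where \<tau>: "strict_mono \<tau>" "(\<lambda>n. z' (\<tau> n)) \<longlonglongrightarrow> q" "q \<in> cball y r"
      by (rule compact_subsequence[OF compact_cball])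
    have qW: "q \<in> W" using \<tau>(3) cW by blast
    have z': "eventually (\<lambda>n. z' n \<in> C n \<and> dist (z' n) y = r \<and> (\<forall>w\<in>C n. F n (z' n) \<le> F n w)) sequentially"
      using z by (rule eventually_mono) (auto simp: z'_def boundary)
    have z'\<tau>: "eventually (\<lambda>n. z' (\<tau> n) \<in> C (\<tau> n) \<and> dist (z' (\<tau> n)) y = r \<and>
        (\<forall>w\<in>C (\<tau> n). F (\<tau> n) (z' (\<tau> n)) \<le> F (\<tau> n) w)) sequentially"
      using eventually_subseq[OF \<tau>(1) z'] .
    have "(\<lambda>n. dist (z' (\<tau> n)) y) \<longlonglongrightarrow> dist q y" by (intro tendsto_intros \<tau>(2))
    moreover have "(\<lambda>n. dist (z' (\<tau> n)) y) \<longlonglongrightarrow> r"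
      by (rule tendsto_eventually) (rule eventually_mono[OF z'\<tau>], blast)
    ultimately have dq: "dist q y = r" by (rule LIMSEQ_unique)
    have "h i q \<le> 0" for i
    proof (rule tendsto_upperbound)
      show "(\<lambda>n. H (\<tau> n) i (z' (\<tau> n))) \<longlonglongrightarrow> h i q"
        by (rule C2_convergesD(4)[OF C2_converges_subseq[OF conv(2) \<tau>(1)] qW \<tau>(2)])
      show "eventually (\<lambda>n. H (\<tau> n) i (z' (\<tau> n)) \<le> 0) sequentially"
        by (rule eventually_mono[OF z'\<tau>]) (simp add: C_def)
    qed simp
    then have gt: "f y < f q" using r1(2)[of q] dq r by auto
    have "f q \<le> f (y + t *\<^sub>R v)" if "G t" for t
    proof (rule tendsto_le[OF sequentially_bot])
      show "(\<lambda>n. F (\<tau> n) (z' (\<tau> n))) \<longlonglongrightarrow> f q"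
        by (rule C2_convergesD(4)[OF C2_converges_subseq[OF conv(1) \<tau>(1)] qW \<tau>(2)])
      have "y + t *\<^sub>R v \<in> W" using that cW unfolding G_def by auto
      then show "(\<lambda>n. F (\<tau> n) (y + t *\<^sub>R v)) \<longlonglongrightarrow> f (y + t *\<^sub>R v)"
        by (rule C2_convergesD(4)[OF C2_converges_subseq[OF conv(1) \<tau>(1)] _ tendsto_const])
      show "eventually (\<lambda>n. F (\<tau> n) (z' (\<tau> n)) \<le> F (\<tau> n) (y + t *\<^sub>R v)) sequentially"
        using z'\<tau> eventually_subseq[OF \<tau>(1) inC[OF that]] by eventually_elim blast
    qed
    then have "eventually (\<lambda>t. f q \<le> f (y + t *\<^sub>R v)) (at_right 0)"
      by (intro eventually_mono[OF G])
    moreover have "((\<lambda>t. f (y + t *\<^sub>R v)) \<longlongrightarrow> f y) (at_right 0)"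
      using line_tendsto[OF f y, where d = v and e = 0] by simp
    ultimately have "f q \<le> f y" by (intro tendsto_lowerbound[where F = "at_right (0::real)"]) auto
    then show False using gt by simp
  qed
  then obtain \<epsilon> where "\<epsilon> > 0" "\<And>F H. \<not> Q \<epsilon> F H" by blast
  then show thesis using that[of \<epsilon>] unfolding Q_def by blast
qed

end

text \<open>Inserting 1 gives \<open>Min\<close> a nonempty set when \<open>M\<close> is
  empty.\<close>

lemma finite_uniform_pos:
  fixes e :: "'a \<Rightarrow> real"
  assumes "finite M" "\<And>y. y \<in> M \<Longrightarrow> e y > 0"
  obtains \<epsilon> where "\<epsilon> > 0" "\<And>y. y \<in> M \<Longrightarrow> \<epsilon> \<le> e y"
  using that[of "Min (insert 1 (e ` M))"] assms by auto

context nondegenerate_problem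
begin

text \<open>Persistence puts a perturbed minimizer near each original one, rigidity makes it the
  only one there with the same active set, and \<open>local_min_near\<close> leaves none elsewhere
  in \<open>K\<close>. The bijection sends each original minimizer to this neighbour.\<close>

lemma local_min_correspondence:
  assumes K: "compact K" "K \<subseteq> W" and inK: "\<And>y. (\<forall>i. h i y \<le> 0) \<Longrightarrow> y \<in> interior K"
  obtains \<epsilon> where "\<epsilon> > 0" "finite {y. local_min f h y}"
    "\<And>F H. near \<epsilon> F H \<Longrightarrow> \<exists>\<phi>. bij_betw \<phi> {y. local_min f h y} {p \<in> K. local_min F H p} \<and>
       (\<forall>y. local_min f h y \<longrightarrow> {i. H i (\<phi> y) = 0} = {i. h i y = 0})"
proof -
  define M where "M = {y. local_min f h y}"
  have Mint: "y \<in> interior K" if "y \<in> M" for y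
    using that inK unfolding M_def local_min_def by blast
  then have MW: "y \<in> W" if "y \<in> M" for y using that K(2) interior_subset[of K] by blast
  define rigid where "rigid y \<rho> \<longleftrightarrow> (\<forall>F H p q. near \<rho> F H \<longrightarrow> local_min F H p \<longrightarrow> local_min F H q \<longrightarrow>
     dist p y < \<rho> \<longrightarrow> dist q y < \<rho> \<longrightarrow> p = q \<and> {i. H i p = 0} = {i. h i y = 0})" for y \<rho>
  have "\<exists>\<rho>>0. rigid y \<rho>" if y: "y \<in> W" for y
  proof -
    obtain \<rho> where "\<rho> > 0" "\<And>F H p q. near \<rho> F H \<Longrightarrow> local_min F H p \<Longrightarrow> local_min F H q \<Longrightarrow> dist p y < \<rho> \<Longrightarrow> dist q y < \<rho> \<Longrightarrow>
       p = q \<and> {i. H i p = 0} = {i. h i y = 0} \<and> local_min f h y"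
      by (rule local_min_rigid[OF y]) (rule that)
    then show ?thesis unfolding rigid_def by blast
  qed
  then obtain R where R: "\<And>y. y \<in> W \<Longrightarrow> R y > 0" "\<And>y. y \<in> W \<Longrightarrow> rigid y (R y)" by metis
  \<comment> \<open>The unperturbed problem is within any tolerance of itself, so rigidity also
    isolates the original minimizers.\<close>
  have self: "p = q" if "y \<in> W" "p \<in> M" "q \<in> M" "dist p y < R y" "dist q y < R y" for y p q
  proof -
    have "near (R y) f h" by (rule near_self) (use R(1)[OF that(1)] in simp)
    then show ?thesis using R(2)[OF that(1)] that(2-5) unfolding rigid_def M_def by blast
  qed
  have fin: "finite M"
  proof -
    \<comment> \<open>The radii exist at every point of \<open>K\<close>, not just at minimizers, so
      compactness yields finiteness of \<open>M\<close>.\<close>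
    have cover: "K \<subseteq> (\<Union>y\<in>K. ball y (R y))"
    proof
      fix y assume "y \<in> K"
      moreover from this have "y \<in> ball y (R y)" using R(1) K(2) by auto
      ultimately show "y \<in> (\<Union>y\<in>K. ball y (R y))" by blast
    qed
    obtain D where D: "D \<subseteq> K" "finite D" "K \<subseteq> (\<Union>y\<in>D. ball y (R y))"
      by (rule compactE_image[OF K(1) open_ball cover])
    have "finite (M \<inter> ball y (R y))" if "y \<in> D" for y
    proof (cases "M \<inter> ball y (R y) = {}")
      case False
      then obtain p where p: "p \<in> M" "dist p y < R y" by (auto simp: dist_commute)
      have "y \<in> W" using that D(1) K(2) by blast
      then have "q = p" if "q \<in> M" "dist q y < R y" for q
        using self[of y q p] that p by blast
      then have "M \<inter> ball y (R y) \<subseteq> {p}" by (auto simp: dist_commute[of y])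
      then show ?thesis by (rule finite_subset) simp
    qed simp
    then have "finite (\<Union>y\<in>D. M \<inter> ball y (R y))" using D(2) by (rule finite_UN_I[rotated])
    moreover have "M \<subseteq> K" using Mint interior_subset[of K] by blast
    then have "M \<subseteq> (\<Union>y\<in>D. M \<inter> ball y (R y))" using D(3) by blast
    ultimately show ?thesis by (rule finite_subset[rotated])
  qed
  \<comment> \<open>Half of \<open>R y\<close> makes the chosen neighbours of distinct minimizers
    distinct; the ball inside \<open>K\<close> ensures that the neighbour is counted.\<close>
  have "\<exists>\<rho>>0. \<rho> \<le> R y / 2 \<and> ball y \<rho> \<subseteq> K" if y: "y \<in> M" for y
  proof -
    obtain k where k: "k > 0" "ball y k \<subseteq> K" using Mint[OF y] by (auto simp: mem_interior)
    have "ball y (min (R y / 2) k) \<subseteq> ball y k" by auto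
    then show ?thesis using k R(1)[OF MW[OF y]] by (intro exI[of _ "min (R y / 2) k"]) auto
  qed
  then obtain \<rho> where \<rho>: "\<And>y. y \<in> M \<Longrightarrow> \<rho> y > 0" "\<And>y. y \<in> M \<Longrightarrow> \<rho> y \<le> R y / 2" "\<And>y. y \<in> M \<Longrightarrow> ball y (\<rho> y) \<subseteq> K"
    by metis
  have "\<exists>\<epsilon>>0. \<forall>F H. near \<epsilon> F H \<longrightarrow> (\<exists>p. local_min F H p \<and> dist p y < \<rho> y)" if y: "y \<in> M" for y
  proof -
    have "local_min f h y" using y unfolding M_def by blast
    then obtain \<epsilon> where "\<epsilon> > 0" "\<And>F H. near \<epsilon> F H \<Longrightarrow> \<exists>p. local_min F H p \<and> dist p y < \<rho> y"
      using local_min_persists[OF MW[OF y] _ \<rho>(1)[OF y]] by metis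
    then show ?thesis by blast
  qed
  then obtain E where E: "\<And>y. y \<in> M \<Longrightarrow> E y > 0"
    "\<And>y F H. y \<in> M \<Longrightarrow> near (E y) F H \<Longrightarrow> \<exists>p. local_min F H p \<and> dist p y < \<rho> y" by metis
  define U where "U = (\<Union>y\<in>M. ball y (\<rho> y))"
  obtain \<epsilon>1 where \<epsilon>1: "\<epsilon>1 > 0" "\<And>F H p. near \<epsilon>1 F H \<Longrightarrow> local_min F H p \<Longrightarrow> p \<in> K \<Longrightarrow> p \<in> U"
  proof (rule local_min_near[OF K, of U])
    show "open U" unfolding U_def by auto
    show "y \<in> U" if "local_min f h y" for y
    proof -
      have "y \<in> M" using that unfolding M_def by simp
      then show ?thesis unfolding U_def using \<rho>(1) by force
    qed
  qed (rule that)
  \<comment> \<open>Finiteness of \<open>M\<close> turns the thresholds for persistence and for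
    rigidity at each minimizer into one.\<close>
  obtain \<epsilon>2 where \<epsilon>2: "\<epsilon>2 > 0" "\<And>y. y \<in> M \<Longrightarrow> \<epsilon>2 \<le> min (E y) (R y)"
    by (rule finite_uniform_pos[OF fin, of "\<lambda>y. min (E y) (R y)"]) (use E(1) R(1) MW that in auto)
  have corr: "\<exists>\<phi>. bij_betw \<phi> M {p \<in> K. local_min F H p} \<and> (\<forall>y\<in>M. {i. H i (\<phi> y) = 0} = {i. h i y = 0})"
    if near: "near (min \<epsilon>1 \<epsilon>2) F H" for F H
  proof -
    have near1: "near \<epsilon>1 F H" using near_mono[OF near] by simp
    have nearE: "near (E y) F H" and nearR: "near (R y) F H" if "y \<in> M" for y
      using near_mono[OF near] \<epsilon>2(2)[OF that] by auto
    obtain \<phi> where \<phi>: "\<And>y. y \<in> M \<Longrightarrow> local_min F H (\<phi> y)" "\<And>y. y \<in> M \<Longrightarrow> dist (\<phi> y) y < \<rho> y"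
      using E(2)[OF _ nearE] by metis
    have lt: "\<rho> y < R y" if "y \<in> M" for y using \<rho>(1,2)[OF that] by linarith
    have unique: "p = \<phi> y \<and> {i. H i (\<phi> y) = 0} = {i. h i y = 0}" if "y \<in> M" "local_min F H p" "dist p y < \<rho> y" for y p
      using R(2)[OF MW[OF that(1)]] nearR[OF that(1)] \<phi>[OF that(1)] that(2,3) lt[OF that(1)]
      unfolding rigid_def by (meson less_trans)
    have "inj_on \<phi> M"
    proof (rule inj_onI)
      fix y y' assume y: "y \<in> M" "y' \<in> M" "\<phi> y = \<phi> y'"
      \<comment> \<open>A common neighbour puts \<open>y\<close> and \<open>y'\<close> within the
        larger of the two rigidity radii, where \<open>self\<close> identifies them.\<close>
      have "dist y y' \<le> dist (\<phi> y) y + dist (\<phi> y') y'"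
        using dist_triangle3[of y y' "\<phi> y"] y(3) by simp
      also have "\<dots> < R y / 2 + R y' / 2" using \<phi>(2)[OF y(1)] \<phi>(2)[OF y(2)] \<rho>(2)[OF y(1)] \<rho>(2)[OF y(2)] by linarith
      finally have "dist y y' < R y \<or> dist y y' < R y'" by linarith
      then show "y = y'"
        using self[OF MW[OF y(1)] y(1,2)] self[OF MW[OF y(2)] y(1,2)] R(1)[OF MW[OF y(1)]] R(1)[OF MW[OF y(2)]]
        unfolding dist_commute[of y' y] by fastforce
    qed
    moreover have "\<phi> ` M = {p \<in> K. local_min F H p}"
    proof (intro equalityI subsetI)
      fix p assume "p \<in> \<phi> ` M"
      then obtain y where y: "y \<in> M" "p = \<phi> y" by blast
      then have "p \<in> ball y (\<rho> y)" using \<phi>(2) by (simp add: dist_commute)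
      then show "p \<in> {p \<in> K. local_min F H p}" using \<rho>(3)[OF y(1)] \<phi>(1)[OF y(1)] y(2) by blast
    next
      fix p assume p: "p \<in> {p \<in> K. local_min F H p}"
      then have "p \<in> U" using \<epsilon>1(2)[OF near1] by blast
      then obtain y where "y \<in> M" "dist p y < \<rho> y" unfolding U_def by (auto simp: dist_commute)
      then show "p \<in> \<phi> ` M" using unique[of y p] p by blast
    qed
    ultimately have "bij_betw \<phi> M {p \<in> K. local_min F H p}" unfolding bij_betw_def by blast
    moreover have "\<forall>y\<in>M. {i. H i (\<phi> y) = 0} = {i. h i y = 0}"
      using unique \<phi> by blast
    ultimately show ?thesis by blast
  qed
  show thesis
  proof (rule that[of "min \<epsilon>1 \<epsilon>2"])
    show "min \<epsilon>1 \<epsilon>2 > 0" using \<epsilon>1(1) \<epsilon>2(1) by simp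
    show "finite {y. local_min f h y}" using fin unfolding M_def .
    show "\<exists>\<phi>. bij_betw \<phi> {y. local_min f h y} {p \<in> K. local_min F H p} \<and>
       (\<forall>y. local_min f h y \<longrightarrow> {i. H i (\<phi> y) = 0} = {i. h i y = 0})" if "near (min \<epsilon>1 \<epsilon>2) F H" for F H
      using corr[OF that] unfolding M_def by simp
  qed
qed

end

section \<open>Smooth functions and \<open>C\<^sup>2\<close>-norms\<close>

lemma C2_on_cong:
  assumes "C2_on f V" "\<And>y. y \<in> V \<Longrightarrow> k y = f y"
  shows "C2_on k V"
proof (rule C2_onI(1)[OF C2_on_D(1)[OF assms(1)] C2_on_D(4)[OF assms(1)] _ C2_on_D(6)[OF assms(1)]])
  fix y assume "y \<in> V"
  then show "(k has_derivative (\<bullet>) (grad f y)) (at y)"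
    using assms(2) by (intro has_derivative_transform_within_open[OF C2_on_D(5)[OF assms(1)] C2_on_D(1)[OF assms(1)]]) auto
qed

lemma C2_on_local:
  assumes "\<And>y. \<exists>V. y \<in> V \<and> C2_on f V"
  shows "C2_on f UNIV"
proof -
  have "isCont (hess f) y \<and> (f has_derivative (\<lambda>v. grad f y \<bullet> v)) (at y) \<and>
     (grad f has_derivative (\<lambda>v. hess f y *v v)) (at y)" for y
  proof -
    obtain V where V: "y \<in> V" "C2_on f V" using assms by blast
    then show ?thesis
      using C2_on_D(1,4)[OF V(2)] C2_on_D(5,6)[OF V(2,1)] by (auto simp: continuous_on_eq_continuous_at)
  qed
  then show ?thesis unfolding C2_on_def by (auto simp: continuous_on_eq_continuous_at)
qed

text \<open>\<open>Ck_on\<close> records continuity only for derivatives along basis vectors.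
  Linearity of the derivative assembles them into gradient and Hessian, whose entries are then
  continuous.\<close>

lemma Ck2_imp_C2_on:
  fixes f :: "real^'m \<Rightarrow> real"
  assumes U: "open U" and C2: "Ck_on 2 f U"
  shows "C2_on f U"
proof -
  define part where "part i y = frechet_derivative f (at y) (axis i 1)" for i y
  define H where "H y = (\<chi> i j. frechet_derivative (part i) (at y) (axis j 1))" for y
  have expand: "v = (\<Sum>i\<in>UNIV. v $ i *\<^sub>R axis i 1)" for v :: "real^'m"
    using basis_expansion[of v] by (simp add: scalar_mult_eq_scaleR)
  have basis: "axis i 1 \<in> (Basis :: (real^'m) set)" for i by (simp add: axis_in_Basis_iff)
  have f: "f differentiable (at y)" if "y \<in> U" for y using C2 that by (simp add: numeral_2_eq_2)
  have C1: "Ck_on (Suc 0) (part i) U" for i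
    using C2 basis[of i] unfolding part_def by (auto simp: numeral_2_eq_2)
  have g: "grad f = (\<lambda>y. \<chi> i. part i y)" unfolding grad_def part_def by simp
  have fd: "(f has_derivative (\<lambda>v. grad f y \<bullet> v)) (at y)" if "y \<in> U" for y
  proof -
    have D: "(f has_derivative frechet_derivative f (at y)) (at y)"
      using f[OF that] by (simp add: frechet_derivative_works)
    have lin: "linear (frechet_derivative f (at y))" using f[OF that] by (rule linear_frechet_derivative)
    have "frechet_derivative f (at y) v = grad f y \<bullet> v" for v
    proof -
      have "frechet_derivative f (at y) v = frechet_derivative f (at y) (\<Sum>i\<in>UNIV. v $ i *\<^sub>R axis i 1)"
        by (rule arg_cong[OF expand])
      also have "\<dots> = (\<Sum>i\<in>UNIV. v $ i * part i y)"
        by (simp add: linear_sum[OF lin] linear_cmul[OF lin] part_def)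
      also have "\<dots> = grad f y \<bullet> v" by (simp add: g inner_vec_def mult.commute)
      finally show ?thesis .
    qed
    then have "frechet_derivative f (at y) = (\<lambda>v. grad f y \<bullet> v)" by blast
    with D show ?thesis by simp
  qed
  have gd: "(grad f has_derivative (\<lambda>v. H y *v v)) (at y)" if y: "y \<in> U" for y
  proof -
    have D: "(part i has_derivative frechet_derivative (part i) (at y)) (at y)" for i
      using C1[of i] y by (simp add: frechet_derivative_works)
    have lin: "linear (frechet_derivative (part i) (at y))" for i
      using C1[of i] y by (intro linear_frechet_derivative) simp
    have "frechet_derivative (part i) (at y) v = (H y *v v) $ i" for i v
    proof -
      have "frechet_derivative (part i) (at y) v = frechet_derivative (part i) (at y) (\<Sum>j\<in>UNIV. v $ j *\<^sub>R axis j 1)"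
        by (rule arg_cong[OF expand])
      also have "\<dots> = (H y *v v) $ i"
        by (simp add: linear_sum[OF lin] linear_cmul[OF lin] H_def matrix_vector_mult_def mult.commute)
      finally show ?thesis .
    qed
    then have "((\<lambda>y. part i y) has_derivative (\<lambda>v. (H y *v v) $ i)) (at y)" for i
      using D[of i] by presburger
    then show ?thesis unfolding g
      by (subst has_derivative_componentwise_within)
        (auto simp: Basis_vec_def inner_axis)
  qed
  have Hc: "continuous_on U H"
    unfolding H_def using C1 basis by (intro continuous_on_vec_lambda) simp
  show ?thesis by (rule C2_onI(1)[OF U Hc fd gd])
qed

lemma Ck_on_cong:
  assumes U: "open U"
  shows "(\<And>y. y \<in> U \<Longrightarrow> f y = k y) \<Longrightarrow> Ck_on n f U \<Longrightarrow> Ck_on n k U"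
proof (induction n arbitrary: f k)
  case 0
  show ?case using iffD1[OF continuous_on_cong[OF refl 0(1)]] 0(2) by simp
next
  case (Suc n)
  have der: "(k has_derivative frechet_derivative f (at y)) (at y)" if y: "y \<in> U" for y
  proof (rule has_derivative_transform_within_open[OF _ U y Suc.prems(1)])
    show "(f has_derivative frechet_derivative f (at y)) (at y)"
      using Suc.prems(2) y by (simp add: frechet_derivative_works)
  qed
  have eq: "frechet_derivative f (at y) b = frechet_derivative k (at y) b" if "y \<in> U" for y b
    by (rule fun_cong[OF frechet_derivative_at[OF der[OF that]]])
  have "Ck_on n (\<lambda>z. frechet_derivative k (at z) b) U" if b: "b \<in> Basis" for b
    by (rule Suc.IH[OF eq]) (use Suc.prems(2) b in simp_all)
  moreover have "k differentiable (at y)" if "y \<in> U" for y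
    using der[OF that] unfolding differentiable_def by blast
  ultimately show ?case by simp
qed

text \<open>The derivative of the slice along \<open>b\<close> is the slice of the derivative of
  \<open>F\<close> along \<open>(0, b)\<close>, again a function of the same kind; hence the
  induction over arbitrary \<open>F\<close>.\<close>

lemma Ck_on_slice:
  fixes F :: "'a::euclidean_space \<times> 'b::euclidean_space \<Rightarrow> real"
  assumes "open {z. (x, z) \<in> U}" "Ck_on k F U"
  shows "Ck_on k (\<lambda>z. F (x, z)) {z. (x, z) \<in> U}"
  using assms(2)
proof (induction k arbitrary: F)
  case 0
  then show ?case
    by (auto intro!: continuous_on_compose2[of U F] continuous_intros)
next
  case (Suc k)
  have der: "((\<lambda>z. F (x, z)) has_derivative (\<lambda>v. frechet_derivative F (at (x, z)) (0, v))) (at z)"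
    if "(x, z) \<in> U" for z
  proof -
    have "(F has_derivative frechet_derivative F (at (x, z))) (at (x, z))"
      using Suc.prems that by (simp add: frechet_derivative_works)
    then show ?thesis
      by (rule has_derivative_compose[where f = "\<lambda>z. (x, z)" and f' = "\<lambda>v. (0, v)" and g = F, rotated])
        (auto intro!: derivative_eq_intros)
  qed
  have "Ck_on k (\<lambda>z. frechet_derivative (\<lambda>z. F (x, z)) (at z) b) {z. (x, z) \<in> U}" if b: "b \<in> Basis" for b
  proof (rule Ck_on_cong[OF assms(1)])
    have "(0, b) \<in> Basis" using b by (simp add: Basis_prod_def)
    then have "Ck_on k (\<lambda>z. frechet_derivative F (at z) (0, b)) U"
      using Suc.prems unfolding Ck_on.simps by blast
    then show "Ck_on k (\<lambda>z. frechet_derivative F (at (x, z)) (0, b)) {z. (x, z) \<in> U}" by (rule Suc.IH)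
    show "frechet_derivative F (at (x, y)) (0, b) = frechet_derivative (\<lambda>z. F (x, z)) (at y) b"
      if "y \<in> {z. (x, z) \<in> U}" for y
      using fun_cong[OF frechet_derivative_at[OF der], of y b] that by simp
  qed
  moreover have "(\<lambda>z. F (x, z)) differentiable (at z)" if "(x, z) \<in> U" for z
    using der[OF that] unfolding differentiable_def by blast
  ultimately show ?case by simp
qed

text \<open>\<open>X\<close> need not be open, but the slice through \<open>x \<in> X\<close> lies
  entirely in \<open>X \<times> UNIV\<close>. A local smooth extension therefore agrees with
  \<open>g\<close> along the slice, and so do its derivatives in \<open>y\<close>.\<close>

lemma smooth_slice_C2_on:
  fixes g :: "real^'n \<Rightarrow> real^'m \<Rightarrow> real"
  assumes g: "smooth_on_set (\<lambda>(u, y). g u y) (X \<times> UNIV)" and x: "x \<in> X"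
  shows "C2_on (g x) UNIV"
proof (rule C2_on_local)
  fix y :: "real^'m"
  have "(x, y) \<in> X \<times> UNIV" using x by simp
  then obtain U F where UF: "open U" "(x, y) \<in> U" "\<forall>k. Ck_on k F U" "\<forall>q\<in>(X \<times> UNIV) \<inter> U. F q = (case q of (u, y) \<Rightarrow> g u y)"
    using g unfolding smooth_on_set_def by blast
  define V where "V = {z. (x, z) \<in> U}"
  have V: "open V"
  proof -
    have "open ((\<lambda>z. (x, z)) -` U)" by (intro open_vimage UF(1) continuous_intros)
    then show ?thesis unfolding V_def vimage_def .
  qed
  have "C2_on (\<lambda>z. F (x, z)) V"
    using UF(3) V unfolding V_def by (intro Ck2_imp_C2_on Ck_on_slice) auto
  moreover have "g x z = F (x, z)" if "z \<in> V" for z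
    using UF(4) that x unfolding V_def by force
  ultimately have "C2_on (g x) V" by (rule C2_on_cong)
  moreover have "y \<in> V" using UF(2) unfolding V_def by simp
  ultimately show "\<exists>V. y \<in> V \<and> C2_on (g x) V" by blast
qed

section \<open>From the C2 norm to pointwise closeness\<close>

lemma norm_matrix_le_onorm:
  fixes A :: "real^'m^'m"
  shows "norm A \<le> real CARD('m) * real CARD('m) * onorm ((*v) A)"
proof -
  have "norm A \<le> (\<Sum>i\<in>UNIV. norm (A $ i))" unfolding norm_vec_def[of A] by (rule L2_set_le_sum) simp
  also have "\<dots> \<le> (\<Sum>i\<in>(UNIV::'m set). \<Sum>j\<in>(UNIV::'m set). \<bar>A $ i $ j\<bar>)" by (intro sum_mono norm_le_l1_cart)
  also have "\<dots> \<le> (\<Sum>i\<in>(UNIV::'m set). \<Sum>j\<in>(UNIV::'m set). onorm ((*v) A))"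
    by (intro sum_mono matrix_component_le_onorm)
  also have "\<dots> = real CARD('m) * real CARD('m) * onorm ((*v) A)" by simp
  finally show ?thesis .
qed

text \<open>A real supremum bounds its family only if the family is bounded above; here this comes
  from continuity on the compact \<open>K\<close>.\<close>

lemma C2_norm_bounds:
  fixes s :: "real^'m \<Rightarrow> real"
  assumes K: "compact K" and s: "C2_near s K" and y: "y \<in> K"
  shows "\<bar>s y\<bar> \<le> C2_norm K s" "norm (grad s y) \<le> C2_norm K s"
    and "norm (hess s y) \<le> real CARD('m) * real CARD('m) * C2_norm K s"
proof -
  obtain U where U: "open U" "K \<subseteq> U" "Ck_on 2 s U" using s unfolding C2_near_def by blast
  note C2 = Ck2_imp_C2_on[OF U(1,3)]
  have bdd: "bdd_above (k ` K)" if "continuous_on K k" for k :: "real^'m \<Rightarrow> real"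
    using compact_continuous_image[OF that K] by (intro bounded_imp_bdd_above compact_imp_bounded)
  have c: "continuous_on K s" "continuous_on K (grad s)" "continuous_on K (hess s)"
    using C2_on_D(2-4)[OF C2] U(2) by (auto intro: continuous_on_subset)
  have b1: "bdd_above ((\<lambda>y. \<bar>s y\<bar>) ` K)" and b2: "bdd_above ((\<lambda>y. norm (grad s y)) ` K)"
    using c by (auto intro!: bdd continuous_intros)
  \<comment> \<open>The sum of the absolute entries is a continuous majorant of the operator
    norm.\<close>
  have "continuous_on K (\<lambda>y. \<Sum>i\<in>UNIV. \<Sum>j\<in>UNIV. \<bar>hess s y $ i $ j\<bar>)"
    using c(3) by (intro continuous_intros)
  from bdd[OF this] obtain B where B: "\<And>y. y \<in> K \<Longrightarrow> (\<Sum>i\<in>UNIV. \<Sum>j\<in>UNIV. \<bar>hess s y $ i $ j\<bar>) \<le> B"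
    unfolding bdd_above_def by auto
  have b3: "bdd_above ((\<lambda>y. onorm ((*v) (hess s y))) ` K)"
    by (rule bdd_aboveI2[of _ _ B]) (use B onorm_le_matrix_component_sum order_trans in blast)
  have "\<bar>s y\<bar> \<le> (SUP y\<in>K. \<bar>s y\<bar>)" by (rule cSUP_upper[OF y b1])
  also have "\<dots> \<le> C2_norm K s" unfolding C2_norm_def by simp
  finally show "\<bar>s y\<bar> \<le> C2_norm K s" .
  have "norm (grad s y) \<le> (SUP y\<in>K. norm (grad s y))" by (rule cSUP_upper[OF y b2])
  also have "\<dots> \<le> C2_norm K s" unfolding C2_norm_def by simp
  finally show "norm (grad s y) \<le> C2_norm K s" .
  have "onorm ((*v) (hess s y)) \<le> (SUP y\<in>K. onorm ((*v) (hess s y)))" by (rule cSUP_upper[OF y b3])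
  also have "\<dots> \<le> C2_norm K s" unfolding C2_norm_def by simp
  finally have "real CARD('m) * real CARD('m) * onorm ((*v) (hess s y)) \<le> real CARD('m) * real CARD('m) * C2_norm K s"
    by (intro mult_left_mono) auto
  with norm_matrix_le_onorm[of "hess s y"]
  show "norm (hess s y) \<le> real CARD('m) * real CARD('m) * C2_norm K s" by linarith
qed

text \<open>The divisor pays for the passage from operator norm to Euclidean norm, at most the
  square of the dimension; the added 1 covers values and gradients.\<close>

lemma C2_close_add:
  fixes s :: "real^'m \<Rightarrow> real"
  assumes f: "C2_on f UNIV" and K: "compact K" "W \<subseteq> K" "open W" and s: "C2_near s K"
    and le: "C2_norm K s \<le> \<epsilon> / (1 + real CARD('m) * real CARD('m))"
  shows "C2_close \<epsilon> (\<lambda>y. f y + s y) f W"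
proof -
  let ?c = "real CARD('m) * real CARD('m)"
  obtain U where U: "open U" "K \<subseteq> U" "Ck_on 2 s U" using s unfolding C2_near_def by blast
  have sW: "C2_on s W" and fW: "C2_on f W"
    using C2_on_subset[OF Ck2_imp_C2_on[OF U(1,3)] K(3)] C2_on_subset[OF f K(3)] U(2) K(2) by auto
  have "\<bar>s y\<bar> \<le> \<epsilon> \<and> norm (grad s y) \<le> \<epsilon> \<and> norm (hess s y) \<le> \<epsilon>" if "y \<in> W" for y
  proof -
    have "y \<in> K" using that K(2) by blast
    note b = C2_norm_bounds[OF K(1) s this]
    have 0: "0 \<le> C2_norm K s" using b(1) by linarith
    have "(1 + ?c) * C2_norm K s \<le> \<epsilon>" using le by (simp add: field_simps add_pos_nonneg)
    then have "C2_norm K s + ?c * C2_norm K s \<le> \<epsilon>" by (simp add: distrib_right)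
    moreover have "0 \<le> ?c * C2_norm K s" using 0 by simp
    ultimately show ?thesis using b 0 by linarith
  qed
  then show ?thesis
    unfolding C2_close_def using C2_on_add[OF fW sW] by simp
qed

section \<open>Counting local minimizers\<close>

lemma local_minimizer_eq: "local_minimizer g h x y \<longleftrightarrow> local_min (g x) (\<lambda>i. h i x) y"
  unfolding local_minimizer_def local_min_def feasible_def by simp

lemma KKT_pair_eq: "KKT_pair g h x y (\<chi> i. l i) \<longleftrightarrow> KKT (g x) (\<lambda>i. h i x) y l"
  unfolding KKT_pair_def KKT_def by simp

lemma KKT_matrix_kernel:
  fixes g :: "real^'n \<Rightarrow> real^'m \<Rightarrow> real" and h :: "'k::finite \<Rightarrow> real^'n \<Rightarrow> real^'m \<Rightarrow> real"
  assumes ns: "nonsingular_on (UNIV <+> J) (KKT_matrix g h x y l)"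
    and M: "hess (\<lambda>z. Lagrangian g h x z l) y *v v = (\<Sum>j\<in>J. \<mu> j *\<^sub>R grad (h j x) y)"
    and v: "\<And>j. j \<in> J \<Longrightarrow> grad (h j x) y \<bullet> v = 0"
  shows "v = 0"
proof -
  let ?A = "KKT_matrix g h x y l" and ?I = "UNIV <+> J :: ('m + 'k) set"
  obtain B where B: "\<And>i j. i \<in> ?I \<Longrightarrow> j \<in> ?I \<Longrightarrow> (\<Sum>p\<in>?I. B i p * ?A p j) = (if i = j then 1 else 0)"
    using ns unfolding nonsingular_on_def by blast
  \<comment> \<open>The minus sign turns the equation for \<open>v\<close> into the first block row
    of a homogeneous KKT system; tangency of \<open>v\<close> is the second.\<close>
  define u where "u p = (case p of Inl a \<Rightarrow> v $ a | Inr j \<Rightarrow> - \<mu> j)" for p :: "'m + 'k"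
  have split: "(\<Sum>q\<in>?I. \<psi> q) = (\<Sum>a\<in>UNIV. \<psi> (Inl a)) + (\<Sum>j\<in>J. \<psi> (Inr j))" for \<psi> :: "'m + 'k \<Rightarrow> real"
    by (simp add: sum.Plus)
  have Au: "(\<Sum>q\<in>?I. ?A p q * u q) = 0" if "p \<in> ?I" for p
  proof (cases p)
    case (Inl a)
    have "(\<Sum>b\<in>UNIV. hess (\<lambda>z. Lagrangian g h x z l) y $ a $ b * v $ b) = (\<Sum>j\<in>J. \<mu> j * grad (h j x) y $ a)"
      using arg_cong[OF M, of "\<lambda>w. w $ a"] by (simp add: matrix_vector_mult_def)
    then show ?thesis unfolding Inl split by (simp add: u_def sum_negf mult.commute)
  next
    case (Inr i)
    then have "i \<in> J" using that by auto
    then show ?thesis using v[of i] unfolding Inr split by (simp add: u_def inner_vec_def)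
  qed
  have "v $ a = 0" for a
  proof -
    have a: "Inl a \<in> ?I" by (rule InlI) simp
    have "v $ a = (\<Sum>q\<in>?I. (if Inl a = q then 1 else 0) * u q)"
      unfolding split by (simp add: u_def if_distrib[of "\<lambda>c. c * _"] cong: if_cong)
    also have "\<dots> = (\<Sum>q\<in>?I. (\<Sum>p\<in>?I. B (Inl a) p * ?A p q) * u q)"
      by (intro sum.cong refl) (simp add: B[OF a])
    also have "\<dots> = (\<Sum>p\<in>?I. B (Inl a) p * (\<Sum>q\<in>?I. ?A p q * u q))"
      unfolding sum_distrib_right sum_distrib_left by (subst sum.swap) (simp add: mult.assoc)
    also have "\<dots> = 0" using Au by (intro sum.neutral) simp
    finally show ?thesis .
  qed
  then show ?thesis by (simp add: vec_eq_iff)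
qed

lemma nondegenerate_problemI:
  fixes g :: "real^'n \<Rightarrow> real^'m \<Rightarrow> real" and h :: "'k::finite \<Rightarrow> real^'n \<Rightarrow> real^'m \<Rightarrow> real"
  assumes g: "C2_on (g x) UNIV" and h: "\<And>i. C2_on (h i x) UNIV" and W: "open W"
    and licq: "LICQ h x" and scsc: "SCSC g h x" and nd: "KKT_nondegenerate g h x"
  shows "nondegenerate_problem (g x) (\<lambda>i. h i x) W"
proof
  show "C2_on (g x) W" "C2_on (h i x) W" for i
    using C2_on_subset[OF g W] C2_on_subset[OF h W] by auto
next
  fix y assume "\<And>i. h i x y \<le> 0"
  then have "y \<in> feasible h x" unfolding feasible_def by simp
  then have "inj_on (\<lambda>i. grad (h i x) y) {i. h i x y = 0}"
    "independent ((\<lambda>i. grad (h i x) y) ` {i. h i x y = 0})"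
    using licq unfolding LICQ_def active_def by auto
  then show "\<exists>e. dual_family {i. h i x y = 0} (\<lambda>i. grad (h i x) y) e"
    by (rule independent_family_dual) blast
next
  fix y l i assume kkt: "KKT (g x) (\<lambda>i. h i x) y l" and "h i x y = 0"
  then have "KKT_pair g h x y (\<chi> i. l i)" by (simp add: KKT_pair_eq)
  then have "h i x y < 0 \<and> (\<chi> i. l i) $ i = 0 \<or> h i x y = 0 \<and> (\<chi> i. l i) $ i > 0"
    using scsc unfolding SCSC_def by blast
  with \<open>h i x y = 0\<close> show "0 < l i" by simp
next
  fix y l v \<mu>
  assume kkt: "KKT (g x) (\<lambda>i. h i x) y l"
    and M: "lagrangian_hess (g x) (\<lambda>i. h i x) l y *v v = (\<Sum>i | h i x y = 0. \<mu> i *\<^sub>R grad (h i x) y)"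
    and v: "\<And>i. h i x y = 0 \<Longrightarrow> grad (h i x) y \<bullet> v = 0"
  have "KKT_pair g h x y (\<chi> i. l i)" using kkt by (simp add: KKT_pair_eq)
  then have ns: "nonsingular_on (UNIV <+> active h x y) (KKT_matrix g h x y (\<chi> i. l i))"
    using nd unfolding KKT_nondegenerate_def by blast
  have L: "hess (\<lambda>z. Lagrangian g h x z (\<chi> i. l i)) y = lagrangian_hess (g x) (\<lambda>i. h i x) l y"
    using C2_on_lagrangian(3)[where f = "g x" and h = "\<lambda>i. h i x" and I = UNIV and l = l, OF g h UNIV_I]
    unfolding Lagrangian_def lagrangian_hess_def by simp
  show "v = 0"
    by (rule KKT_matrix_kernel[OF ns]) (use M v in \<open>auto simp: L active_def\<close>)
qed

text \<open>With the active set as label, a single bijection settles the counts for all strata at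
  once, so one threshold serves every \<open>J\<close>.\<close>

lemma bij_betw_classes:
  assumes bij: "bij_betw \<phi> A B" and "finite A" and cls: "\<And>a. a \<in> A \<Longrightarrow> d (\<phi> a) = c a"
  shows "finite {a \<in> A. c a = J} \<and> finite {b \<in> B. d b = J} \<and> card {a \<in> A. c a = J} = card {b \<in> B. d b = J}"
proof -
  have "\<phi> ` {a \<in> A. c a = J} = {b \<in> B. d b = J}"
    using bij cls unfolding bij_betw_def by auto
  moreover have "inj_on \<phi> {a \<in> A. c a = J}"
    using bij unfolding bij_betw_def by (auto intro: inj_on_subset)
  ultimately have "bij_betw \<phi> {a \<in> A. c a = J} {b \<in> B. d b = J}" unfolding bij_betw_def by blast
  moreover have "finite {a \<in> A. c a = J}" using assms(2) by simp
  ultimately show ?thesis using bij_betw_finite bij_betw_same_card by blast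
qed

text \<open>Finiteness accompanies the equality because \<open>card\<close> of an infinite set is 0,
  so equal cards alone would not mean equal numbers.\<close>

theorem theorem2p9:
  fixes X :: "(real^'n) set"
    and g :: "real^'n \<Rightarrow> real^'m \<Rightarrow> real"
    and h :: "'k::finite \<Rightarrow> real^'n \<Rightarrow> real^'m \<Rightarrow> real"
    and x :: "real^'n"
    and K_in K_out :: "(real^'m) set"
  assumes g_smooth: "smooth_on_set (\<lambda>(u, y). g u y) (X \<times> UNIV)"
    and h_smooth: "\<And>i. smooth_on_set (\<lambda>(u, y). h i u y) (X \<times> UNIV)"
    and nonempty: "\<And>u. u \<in> X \<Longrightarrow> feasible h u \<noteq> {}"
    and x_in: "x \<in> X"
    and bounded: "bounded (feasible h x)"
    and LICQ: "LICQ h x"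
    and SCSC: "SCSC g h x"
    and nondegenerate: "KKT_nondegenerate g h x"
    and K_in: "compact K_in" "feasible h x \<subseteq> interior K_in"
    and K_out: "compact K_out" "K_in \<subseteq> interior K_out"
  shows "\<exists>\<epsilon>>0. \<forall>s r.
           C2_near (s x) K_out \<and> (\<forall>i. C2_near (r i x) K_out) \<and>
           C2_norm K_out (s x) + (MAX i. C2_norm K_out (r i x)) \<le> \<epsilon> \<longrightarrow>
           (\<forall>J.
              finite {y \<in> stratum h J x. local_minimizer g h x y} \<and>
              finite {y \<in> stratum (perturb_con h r) J x \<inter> K_in.
                        local_minimizer (perturb_obj g s) (perturb_con h r) x y} \<and>
              card {y \<in> stratum h J x. local_minimizer g h x y} =
              card {y \<in> stratum (perturb_con h r) J x \<inter> K_in.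
                      local_minimizer (perturb_obj g s) (perturb_con h r) x y})"
proof -
  \<comment> \<open>The interior is open and contains \<open>K_in\<close>, as the C2 analysis
    requires, and lies in \<open>K_out\<close>, where the perturbation norm gives bounds.\<close>
  define W where "W = interior K_out"
  define f where "f = g x"
  define c where "c i = h i x" for i
  have fU: "C2_on f UNIV" unfolding f_def by (rule smooth_slice_C2_on[OF g_smooth x_in])
  have cU: "C2_on (c i) UNIV" for i unfolding c_def by (rule smooth_slice_C2_on[OF h_smooth x_in])
  have W: "open W" "W \<subseteq> K_out" unfolding W_def by (auto simp: interior_subset)
  interpret nondegenerate_problem f c W
    unfolding f_def c_def[abs_def]
    by (rule nondegenerate_problemI[OF fU[unfolded f_def] cU[unfolded c_def] W(1) LICQ SCSC nondegenerate])
  have inK: "y \<in> interior K_in" if "\<forall>i. c i y \<le> 0" for y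
    using that K_in(2) unfolding feasible_def c_def by blast
  obtain \<epsilon> where \<epsilon>: "\<epsilon> > 0" "finite {y. local_min f c y}"
    "\<And>F H. near \<epsilon> F H \<Longrightarrow> \<exists>\<phi>. bij_betw \<phi> {y. local_min f c y} {p \<in> K_in. local_min F H p} \<and>
       (\<forall>y. local_min f c y \<longrightarrow> {i. H i (\<phi> y) = 0} = {i. c i y = 0})"
    by (rule local_min_correspondence[OF K_in(1) _ inK]) (use K_out(2) that in \<open>auto simp: W_def\<close>)
  \<comment> \<open>Evaluation at a point of \<open>K_out\<close> shows that the norms are
    nonnegative, so the bound on the sum passes to each perturbation separately.\<close>
  obtain y0 where y0: "y0 \<in> K_out"
    using nonempty[OF x_in] K_in(2) K_out(2) interior_subset[of K_in] interior_subset[of K_out] by blast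
  define \<eta> where "\<eta> = \<epsilon> / (1 + real CARD('m) * real CARD('m))"
  have "1 + real CARD('m) * real CARD('m) > 0" by (simp add: add_pos_nonneg)
  then have \<eta>: "\<eta> > 0" unfolding \<eta>_def using \<epsilon>(1) by simp
  have count: "finite {y \<in> stratum h J x. local_minimizer g h x y} \<and>
              finite {y \<in> stratum (perturb_con h r) J x \<inter> K_in.
                        local_minimizer (perturb_obj g s) (perturb_con h r) x y} \<and>
              card {y \<in> stratum h J x. local_minimizer g h x y} =
              card {y \<in> stratum (perturb_con h r) J x \<inter> K_in.
                      local_minimizer (perturb_obj g s) (perturb_con h r) x y}"
    if s: "C2_near (s x) K_out" and r: "\<And>i. C2_near (r i x) K_out"
      and le: "C2_norm K_out (s x) + (MAX i. C2_norm K_out (r i x)) \<le> \<eta>" for s r J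
  proof -
    have 0: "0 \<le> C2_norm K_out (s x)" "0 \<le> C2_norm K_out (r i x)" for i
      using C2_norm_bounds(1)[OF K_out(1) s y0] C2_norm_bounds(1)[OF K_out(1) r y0, of i] by linarith+
    have max: "C2_norm K_out (r i x) \<le> (MAX i. C2_norm K_out (r i x))" for i by (intro Max_ge) auto
    have s_le: "C2_norm K_out (s x) \<le> \<eta>" using le 0(2) max by (meson add_increasing2 order_trans order_refl)
    have r_le: "C2_norm K_out (r i x) \<le> \<eta>" for i using le 0(1) max[of i] by linarith
    let ?F = "\<lambda>y. f y + s x y" and ?H = "\<lambda>i y. c i y + r i x y"
    have "near \<epsilon> ?F ?H"
      unfolding near_def
      using C2_close_add[OF fU K_out(1) W(2,1) s s_le[unfolded \<eta>_def]]
        C2_close_add[OF cU K_out(1) W(2,1) r r_le[unfolded \<eta>_def]] by blast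
    then obtain \<phi> where \<phi>: "bij_betw \<phi> {y. local_min f c y} {p \<in> K_in. local_min ?F ?H p}"
      "\<And>y. y \<in> {y. local_min f c y} \<Longrightarrow> {i. ?H i (\<phi> y) = 0} = {i. c i y = 0}"
      using \<epsilon>(3) by blast
    have "{y \<in> stratum h J x. local_minimizer g h x y} = {y \<in> {y. local_min f c y}. {i. c i y = 0} = J}"
      unfolding local_minimizer_eq stratum_def feasible_def active_def f_def c_def
      by (auto simp: local_min_def)
    moreover have "{y \<in> stratum (perturb_con h r) J x \<inter> K_in.
        local_minimizer (perturb_obj g s) (perturb_con h r) x y}
        = {p \<in> {p \<in> K_in. local_min ?F ?H p}. {i. ?H i p = 0} = J}"
      unfolding local_minimizer_eq stratum_def feasible_def active_def f_def c_def perturb_obj_def perturb_con_def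
      by (auto simp: local_min_def)
    ultimately show ?thesis
      using bij_betw_classes[OF \<phi>(1) \<epsilon>(2), of "\<lambda>p. {i. ?H i p = 0}" "\<lambda>y. {i. c i y = 0}" J] \<phi>(2) by presburger
  qed
  show ?thesis
    using \<eta> count by blast
qed

end
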